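(* For every $n\ge1$ and every ordered set partition $\Pi$ of $[n]=\{1,\dots,n\}$, $$\sum_{MPF \in \mathcal{MPF}(\Pi)} t^{\operatorname{area}(MPF)} q^{\operatorname{dinv}(MPF)} = t^{\operatorname{maj}(\tau(\Pi))} \prod_{c=1}^{n} \left[ w_\Pi(c) \right]_q,$$ where $[m]_q=1+q+\dots+q^{m-1}$.
   Context: Parking functions: a Dyck path of size $n$ goes from $(0,0)$ to $(n,n)$ with unit North/East steps weakly above $y=x$; a parking function of size $n$ with labels $[n]$ is such a path with the cars $1,\dots,n$ placed one in the cell immediately right of each North step, increasing upward in each column. The cell with lower-left corner $(i,j)$ lies in the $(j-i)$-diagonal; left/right for cars refers to columns. $\operatorname{area}$ is the number of full cells between the path and $y=x$. A valley is an East step immediately followed by a North step such that the cell directly below the East step has no car or has a car smaller than the car next to that North step. A valley-marked parking function is a parking function with a subset of its valleys marked; the car next to a marked valley's North step is called marked. For cars $s<b$: a primary diagonal inversion occurs if $s,b$ are in the same diagonal, $s$ is to the left of $b$, and $s$ is unmarked; a secondary diagonal inversion occurs if $b$ is in the diagonal one above $s$'s, $b$ is to the left of $s$, and $b$ is unmarked. $\operatorname{dinv}$ is the number of primary and secondary diagonal inversions minus the number of marked valleys. The type of a marked parking function is the marked word obtained by listing, for each nonempty diagonal from the highest to the $0$-diagonal, its cars in increasing order, with a car marked iff it is marked in the parking function. For an ordered set partition $\Pi=(B_1,\dots,B_m)$, define $\tau(\Pi)$ recursively: if $m=1$, list $B_1$ increasingly; otherwise, with $\Pi'=(B_2,\dots,B_m)$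 and $r$ the first letter of $\tau(\Pi')$, $\tau(\Pi)$ is the elements of $B_1$ larger than $r$ increasingly, then the elements of $B_1$ smaller than $r$ increasingly, then $\tau(\Pi')$. $\tau^*(\Pi)$ is $\tau(\Pi)$ with every entry marked except the leftmost entry of each block's contiguous segment. $\mathcal{MPF}(\Pi)$ is the set of valley-marked parking functions with labels $[n]$ whose type is $\tau^*(\Pi)$. For a word $\tau$, $\operatorname{maj}(\tau)=\sum_{i:\tau_i>\tau_{i+1}} i$. A run is a maximal contiguous increasing subword. Schedule numbers: append an unmarked $0$ to the end of $\tau^*(\Pi)$ and consider the runs of the resulting word. For unmarked $c$, $w_\Pi(c)$ is the number of unmarked entries larger than $c$ in the same run plus the number of unmarked entries (including the $0$) smaller than $c$ in the next run. For marked $c$, $w_\Pi(c)$ is the number of unmarked entries smaller than $c$ in the same run plus the number of unmarked entries larger than $c$ in the previous run. *)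

theory Defs
  imports Complex_Main "HOL-Library.Disjoint_Sets"
begin

datatype step = North | East

definition point_at :: "step list \<Rightarrow> nat \<Rightarrow> nat \<times> nat" where
  "point_at p k = (count_list (take k p) East, count_list (take k p) North)"

definition dyck_path :: "nat \<Rightarrow> step list \<Rightarrow> bool" where
  "dyck_path n p \<longleftrightarrow> point_at p (length p) = (n, n) \<and>
     (\<forall>k\<le>length p. fst (point_at p k) \<le> snd (point_at p k))"

text \<open>A cell is named by its lower-left corner, so the cell immediately to the right of a North
  step is named by the starting point of that step.\<close>

definition north_cells :: "step list \<Rightarrow> (nat \<times> nat) set" where
  "north_cells p = {point_at p k | k. k < length p \<and> p ! k = North}"

definition diagonal :: "nat \<times> nat \<Rightarrow> int" where
  "diagonal x = int (snd x) - int (fst x)"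

text \<open>Each row contains exactly one North step; the car in row \<open>j\<close> is \<open>cs ! j\<close>, rows being numbered
  from \<open>0\<close>.\<close>

definition car_at :: "step list \<Rightarrow> nat list \<Rightarrow> nat \<times> nat \<Rightarrow> nat \<Rightarrow> bool" where
  "car_at p cs x c \<longleftrightarrow> x \<in> north_cells p \<and> c = cs ! snd x"

definition parking_function :: "nat \<Rightarrow> step list \<Rightarrow> nat list \<Rightarrow> bool" where
  "parking_function n p cs \<longleftrightarrow> dyck_path n p \<and>
     length cs = n \<and> distinct cs \<and> set cs = {1..n} \<and>
     (\<forall>i j j' c c'. car_at p cs (i, j) c \<and> car_at p cs (i, j') c' \<and> j < j' \<longrightarrow> c < c')"

text \<open>A valley is represented by the position in \<open>p\<close> of its East step, which runs from
  \<open>(i, j + 1)\<close> to \<open>(i + 1, j + 1)\<close>; the cell directly below it is \<open>(i, j)\<close>.\<close>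

definition valleys :: "step list \<Rightarrow> nat list \<Rightarrow> nat set" where
  "valleys p cs = {k. Suc k < length p \<and> p ! k = East \<and> p ! Suc k = North \<and>
     (\<exists>i j b. point_at p k = (i, Suc j) \<and> car_at p cs (Suc i, Suc j) b \<and>
        (\<forall>s. car_at p cs (i, j) s \<longrightarrow> s < b))}"

record mpf =
  mpf_path :: "step list"
  mpf_cars :: "nat list"
  mpf_marks :: "nat set"

definition marked_parking_function :: "nat \<Rightarrow> mpf \<Rightarrow> bool" where
  "marked_parking_function n P \<longleftrightarrow> parking_function n (mpf_path P) (mpf_cars P) \<and>
     mpf_marks P \<subseteq> valleys (mpf_path P) (mpf_cars P)"

abbreviation mpf_car_at :: "mpf \<Rightarrow> nat \<times> nat \<Rightarrow> nat \<Rightarrow> bool" where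
  "mpf_car_at P \<equiv> car_at (mpf_path P) (mpf_cars P)"

definition marked_cars :: "mpf \<Rightarrow> nat set" where
  "marked_cars P = {c. \<exists>k\<in>mpf_marks P. mpf_car_at P (point_at (mpf_path P) (Suc k)) c}"

text \<open>A cell \<open>(x, y)\<close> lies entirely on or above the line \<open>y = x\<close> iff its lower-right corner
  \<open>(x + 1, y)\<close> does.\<close>

definition mpf_area :: "mpf \<Rightarrow> nat" where
  "mpf_area P = card {(x, y). (\<exists>i\<le>x. (i, y) \<in> north_cells (mpf_path P)) \<and> x + 1 \<le> y}"

definition primary_dinv :: "mpf \<Rightarrow> (nat \<times> nat) set" where
  "primary_dinv P = {(s, b). s < b \<and> s \<notin> marked_cars P \<and>
     (\<exists>x y. mpf_car_at P x s \<and> mpf_car_at P y b \<and> diagonal x = diagonal y \<and> fst x < fst y)}"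

definition secondary_dinv :: "mpf \<Rightarrow> (nat \<times> nat) set" where
  "secondary_dinv P = {(s, b). s < b \<and> b \<notin> marked_cars P \<and>
     (\<exists>x y. mpf_car_at P x s \<and> mpf_car_at P y b \<and> diagonal y = diagonal x + 1 \<and> fst y < fst x)}"

definition mpf_dinv :: "mpf \<Rightarrow> int" where
  "mpf_dinv P = int (card (primary_dinv P)) + int (card (secondary_dinv P))
     - int (card (mpf_marks P))"

text \<open>A marked word is a list of letters paired with a flag that is \<open>True\<close> iff the letter is marked.
  For a path of size \<open>n\<close> every nonempty diagonal has index below \<open>n\<close>.\<close>

definition diagonal_cars :: "mpf \<Rightarrow> nat \<Rightarrow> nat set" where
  "diagonal_cars P d = {c. \<exists>x. mpf_car_at P x c \<and> diagonal x = int d}"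

definition mpf_type :: "nat \<Rightarrow> mpf \<Rightarrow> (nat \<times> bool) list" where
  "mpf_type n P = concat (map (\<lambda>d. map (\<lambda>c. (c, c \<in> marked_cars P))
     (sorted_list_of_set (diagonal_cars P d))) (rev [0..<n]))"


definition ordered_set_partition :: "'a set \<Rightarrow> 'a set list \<Rightarrow> bool" where
  "ordered_set_partition A Bs \<longleftrightarrow> partition_on A (set Bs) \<and> distinct Bs"

fun tau :: "nat set list \<Rightarrow> nat list" where
  "tau [] = []"
| "tau [B] = sorted_list_of_set B"
| "tau (B # B' # Bs) =
     (let w = tau (B' # Bs); r = hd w
      in sorted_list_of_set {x \<in> B. x > r} @ sorted_list_of_set {x \<in> B. x < r} @ w)"

fun mark_tail :: "nat list \<Rightarrow> (nat \<times> bool) list" where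
  "mark_tail [] = []"
| "mark_tail (x # xs) = (x, False) # map (\<lambda>y. (y, True)) xs"

text \<open>The segment of the first block consists of the first \<open>card B\<close> letters.\<close>

fun tau_star :: "nat set list \<Rightarrow> (nat \<times> bool) list" where
  "tau_star [] = []"
| "tau_star (B # Bs) = mark_tail (take (card B) (tau (B # Bs))) @ tau_star Bs"

definition MPF :: "nat \<Rightarrow> nat set list \<Rightarrow> mpf set" where
  "MPF n Bs = {P. marked_parking_function n P \<and> mpf_type n P = tau_star Bs}"

definition maj :: "nat list \<Rightarrow> nat" where
  "maj w = (\<Sum>i | 1 \<le> i \<and> i < length w \<and> w ! (i - 1) > w ! i. i)"

fun increasing_runs :: "(nat \<times> bool) list \<Rightarrow> (nat \<times> bool) list list" where
  "increasing_runs [] = []"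
| "increasing_runs [x] = [[x]]"
| "increasing_runs (x # y # ys) =
     (let R = increasing_runs (y # ys)
      in if fst x < fst y then (x # hd R) # tl R else [x] # R)"

text \<open>The letters of a marked word that is considered here are distinct, so letters may be counted
  through sets.\<close>

definition schedule_number :: "nat set list \<Rightarrow> nat \<Rightarrow> nat" where
  "schedule_number Bs c =
     (let R = increasing_runs (tau_star Bs @ [(0, False)]);
          k = (THE k. k < length R \<and> c \<in> fst ` set (R ! k));
          unmarked = (\<lambda>j. {d. (d, False) \<in> set (R ! j)})
      in if c \<in> unmarked k
         then card {d \<in> unmarked k. d > c} + card {d. Suc k < length R \<and> d \<in> unmarked (Suc k) \<and> d < c}
         else card {d \<in> unmarked k. d < c} + card {d. 0 < k \<and> d \<in> unmarked (k - 1) \<and> d > c})"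

definition q_number :: "'a::comm_semiring_1 \<Rightarrow> nat \<Rightarrow> 'a" where
  "q_number q m = (\<Sum>i<m. q ^ i)"

end

theory Submission
  imports Defs
begin

text \<open>Read the cars of a marked parking function row by row, and put a fictitious car \<open>0\<close> on level
  \<open>0\<close> in front, a car of the \<open>d\<close>-diagonal having level \<open>d + 1\<close>. The path can be recovered from the
  levels, and a word of cars comes from a marked parking function iff every two consecutive letters
  satisfy a local condition. The first car of the
  word on a level follows a smaller car one level below, so the diagonals are the runs of the type;
  hence the type prescribes level and mark of every car, and the area is the major index.

  The words are then built by inserting the cars one at a time: first the unmarked ones, by
  increasing level and within a level from the largest to the smallest, then the marked ones in any
  order. A car \<open>c\<close> has \<open>w(c)\<close> eligible cars. An unmarked \<open>c\<close> may be inserted exactly behind an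
  eligible car, and creates one inversion with each eligible car to its right. A marked \<open>c\<close> has
  exactly one admissible place between each eligible car and the next one, and creates one inversion
  with each eligible car to its left, one of which is cancelled by the mark. Either way \<open>c\<close>
  contributes the factor \<open>[w(c)]\<^sub>q\<close>.\<close>

subsection \<open>Words of cars\<close>

text \<open>Place \<open>i\<close> of \<open>xs\<close> lies behind the letter
  \<open>last (z # take i xs)\<close>, with \<open>z\<close> in front of the word. Over the places
  behind letters with \<open>E\<close>, the number of such letters further right takes each value
  below their total exactly once. This yields a q-number when \<open>g\<close> is a power of
  \<open>q\<close>.\<close>

lemma sum_unmarked_gaps:
  fixes g :: "nat \<Rightarrow> 'b::comm_monoid_add"
  shows "(\<Sum>i\<le>length xs. if E (last (z # take i xs)) then g (length (filter E (drop i xs))) else 0) =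
    (\<Sum>k<length (filter E (z # xs)). g k)"
proof (induction xs arbitrary: z)
  case (Cons x xs)
  let ?f = "\<lambda>z xs i. if E (last (z # take i xs)) then g (length (filter E (drop i xs))) else 0"
  have "(\<Sum>i\<le>length (x # xs). ?f z (x # xs) i) =
      (if E z then g (length (filter E (x # xs))) else 0) + (\<Sum>i\<le>length xs. ?f x xs i)"
    unfolding length_Cons sum.atMost_Suc_shift by (simp cong: if_cong)
  then show ?case
    unfolding Cons.IH by (simp add: add.commute)
qed simp

lemma split_at_first:
  assumes "c \<notin> set us"
  shows "takeWhile (\<lambda>x. x \<noteq> c) (us @ c # vs) = us" "dropWhile (\<lambda>x. x \<noteq> c) (us @ c # vs) = c # vs"
  using assms by (induction us) auto

text \<open>From outside \<open>H\<close> one gets back into it only at a letter with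
  \<open>E\<close>. So behind each \<open>E\<close> letter come letters in \<open>H\<close>, then
  letters outside, until the next \<open>E\<close> letter, and the only place left is behind the
  last of those \<open>H\<close> letters. In front of the first \<open>E\<close> letter there is
  such a place only if \<open>z\<close> has \<open>H\<close>. The offset \<open>b\<close> counts the
  \<open>E\<close> letters that the induction has already passed.\<close>

lemma sum_marked_gaps:
  fixes g :: "nat \<Rightarrow> 'b::comm_monoid_add"
  assumes "successively (\<lambda>x y. H y \<longrightarrow> H x \<or> E y) (z # xs)" "\<forall>x. E x \<longrightarrow> H x"
  shows "(\<Sum>i\<le>length xs. if H (last (z # take i xs)) \<and>
      (drop i xs = [] \<or> \<not> H (hd (drop i xs)) \<or> E (hd (drop i xs)))
      then g (b + length (filter E (take i xs))) else 0) =
    (\<Sum>k\<in>{(if H z then 0 else 1)..length (filter E xs)}. g (b + k))"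
  using assms(1)
proof (induction xs arbitrary: z b)
  case (Cons x xs)
  let ?L = "\<lambda>b z xs. (\<Sum>i\<le>length xs. if H (last (z # take i xs)) \<and>
      (drop i xs = [] \<or> \<not> H (hd (drop i xs)) \<or> E (hd (drop i xs)))
      then g (b + length (filter E (take i xs))) else 0)"
  have shift: "(\<Sum>k\<in>{0..n}. g (b + k)) = g b + (\<Sum>k\<in>{1..n}. g (b + k))" for b n
    by (simp add: sum.atLeast_Suc_atMost)
  have shift1: "(\<Sum>k\<in>{1..Suc n}. g (b + k)) = (\<Sum>k\<in>{0..n}. g (Suc b + k))" for b n
    using sum.shift_bounds_cl_Suc_ivl[of "\<lambda>k. g (b + k)" 0 n] by simp
  have IH: "?L b x xs = (\<Sum>k\<in>{(if H x then 0 else 1)..length (filter E xs)}. g (b + k))" for b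
    using Cons by simp
  \<comment> \<open>Split off the place before \<open>x\<close>; if \<open>E x\<close> holds,
    \<open>x\<close> precedes all remaining places and raises the offset.\<close>
  have "?L b z (x # xs) = (if H z \<and> (\<not> H x \<or> E x) then g b else 0) +
      ?L (if E x then Suc b else b) x xs"
    by (simp add: sum.atMost_Suc_shift del: sum.atMost_Suc cong: if_cong)
  also have "\<dots> = (if H z \<and> (\<not> H x \<or> E x) then g b else 0) +
     (\<Sum>k\<in>{(if H x then 0 else 1)..length (filter E xs)}. g ((if E x then Suc b else b) + k))"
    by (simp only: IH)
  also have "\<dots> = (\<Sum>k\<in>{(if H z then 0 else 1)..length (filter E (x # xs))}. g (b + k))"
    using Cons.prems assms(2)
    by (cases "H z"; cases "H x"; cases "E x") (auto simp: shift shift1[simplified] add.assoc)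
  finally show ?case .
qed simp

lemma takeWhile_dropWhile_nth:
  assumes "distinct xs" "j < length xs"
  shows "takeWhile (\<lambda>x. x \<noteq> xs ! j) xs = take j xs" "dropWhile (\<lambda>x. x \<noteq> xs ! j) xs = drop j xs"
proof -
  have xs: "xs = take j xs @ xs ! j # drop (Suc j) xs" "drop j xs = xs ! j # drop (Suc j) xs"
    using assms(2) by (simp_all add: id_take_nth_drop Cons_nth_drop_Suc)
  have "xs ! j \<notin> set (take j xs)"
    using assms by (auto simp: in_set_conv_nth nth_eq_iff_index_eq)
  from split_at_first[OF this, of "drop (Suc j) xs"]
  show "takeWhile (\<lambda>x. x \<noteq> xs ! j) xs = take j xs" "dropWhile (\<lambda>x. x \<noteq> xs ! j) xs = drop j xs"
    using xs by simp_all
qed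

lemma successively_remove:
  assumes "successively R (z # us @ c # vs)"
    "vs \<noteq> [] \<Longrightarrow> R (last (z # us)) c \<Longrightarrow> R c (hd vs) \<Longrightarrow> R (last (z # us)) (hd vs)"
  shows "successively R (z # us @ vs)"
  using assms successively_append_iff[of R "z # us" "c # vs"] successively_append_iff[of R "z # us" vs]
    successively_Cons[of R c vs]
  by (cases "vs = []") auto

section \<open>Words with prescribed levels and marks\<close>

locale levelled_cars =
  fixes lev :: "nat \<Rightarrow> nat" and M :: "nat set"
  assumes lev_0: "lev 0 = 0" and unmarked_0: "0 \<notin> M"
begin

text \<open>\<open>adj p c\<close>: the row of \<open>c\<close> may lie directly above the row of \<open>p\<close>, where a marked \<open>c\<close> needs a
  valley. With \<open>p = 0\<close> it says that \<open>c\<close> may be the lowest row.\<close>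

definition adj :: "nat \<Rightarrow> nat \<Rightarrow> bool" where
  "adj p c \<longleftrightarrow> (if c \<in> M then lev c < lev p \<or> lev c = lev p \<and> p < c
     else lev c \<le> lev p \<or> lev c = Suc (lev p) \<and> p < c)"

definition words :: "nat set \<Rightarrow> nat list set" where
  "words S = {xs. distinct xs \<and> set xs = S \<and> successively adj (0 # xs)}"

text \<open>For an unmarked \<open>c\<close> these are the unmarked cars that form an inversion with
  \<open>c\<close> when they stand to its right; for a marked \<open>c\<close>, when they stand to
  its left. The fictitious car \<open>0\<close> can be eligible too: being in front it forms no
  inversion, but it opens the first place.\<close>

definition elig :: "nat \<Rightarrow> nat set" where
  "elig c = {e. e \<notin> M \<and> (if c \<in> M then lev e = lev c \<and> e < c \<or> lev e = Suc (lev c) \<and> c < e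
     else lev e = lev c \<and> c < e \<or> Suc (lev e) = lev c \<and> e < c)}"

text \<open>An inversion between two unmarked cars is attributed to the left one, any other one to its
  marked car. In a word of \<open>words S\<close> the subtraction does not truncate, see
  \<open>marked_has_elig_before\<close>.\<close>

definition car_dinv :: "nat list \<Rightarrow> nat \<Rightarrow> nat" where
  "car_dinv xs c = (if c \<in> M then card (set (takeWhile (\<lambda>x. x \<noteq> c) xs) \<inter> elig c) - 1
     else card (set (tl (dropWhile (\<lambda>x. x \<noteq> c) xs)) \<inter> elig c))"

definition word_dinv :: "nat list \<Rightarrow> nat" where
  "word_dinv xs = (\<Sum>c\<in>set xs. car_dinv xs c)"

lemma finite_words: "finite S \<Longrightarrow> finite (words S)"
  unfolding words_def
  by (rule finite_subset[OF _ finite_lists_length_le[of S "card S"]]) (auto simp: distinct_card)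

section \<open>Inserting one car into a word\<close>

lemma car_dinv_insert:
  assumes "c \<notin> set us" "c \<notin> set vs"
  shows "car_dinv (us @ c # vs) c =
    (if c \<in> M then card (set us \<inter> elig c) - 1 else card (set vs \<inter> elig c))"
  using split_at_first[OF assms(1), of vs] by (simp add: car_dinv_def)

lemma car_dinv_remove:
  assumes "c \<notin> elig e" "e \<noteq> c" "e \<in> set us \<union> set vs"
  shows "car_dinv (us @ c # vs) e = car_dinv (us @ vs) e"
proof (cases "e \<in> set us")
  case True
  then show ?thesis using assms
    by (auto simp: car_dinv_def takeWhile_append1 dropWhile_append1 tl_append split: list.split)
next
  case False
  then have "takeWhile (\<lambda>x. x \<noteq> e) (us @ ys) = us @ takeWhile (\<lambda>x. x \<noteq> e) ys"
    "dropWhile (\<lambda>x. x \<noteq> e) (us @ ys) = dropWhile (\<lambda>x. x \<noteq> e) ys" for ys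
    by (induction us) auto
  then show ?thesis using assms by (auto simp: car_dinv_def)
qed

lemma successively_insert_iff:
  assumes "successively adj (0 # us @ vs)"
  shows "successively adj (0 # us @ c # vs) \<longleftrightarrow>
    adj (last (0 # us)) c \<and> (vs = [] \<or> adj c (hd vs))"
proof -
  have "successively adj (0 # us)" "successively adj vs"
    using assms successively_append_iff[of adj "0 # us" vs] by simp_all
  then show ?thesis
    using successively_append_iff[of adj "0 # us" "c # vs"] successively_Cons[of adj c vs]
    by auto
qed

text \<open>A word with \<open>c\<close> amounts to a word without \<open>c\<close> and a place for
  \<open>c\<close>, and only the two neighbours of that place restrict the choice. The hypothesis
  \<open>remove\<close> ensures that deleting \<open>c\<close> leaves a word of
  \<open>words S\<close>.\<close>

lemma sum_words_insert:
  fixes h :: "nat list \<Rightarrow> 'b::comm_monoid_add"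
  assumes "finite S" "c \<notin> S"
    and remove: "\<And>us vs. us @ c # vs \<in> words (insert c S) \<Longrightarrow> us @ vs \<in> words S"
  shows "(\<Sum>w\<in>words (insert c S). h w) = (\<Sum>xs\<in>words S. \<Sum>i\<le>length xs.
    if adj (last (0 # take i xs)) c \<and> (drop i xs = [] \<or> adj c (hd (drop i xs)))
    then h (take i xs @ c # drop i xs) else 0)"
proof -
  let ?C = "\<lambda>xs i. adj (last (0 # take i xs)) c \<and> (drop i xs = [] \<or> adj c (hd (drop i xs)))"
  let ?I = "\<lambda>xs i. take i xs @ c # drop i xs"
  let ?P = "Sigma (words S) (\<lambda>xs. {i. i \<le> length xs \<and> ?C xs i})"
  have I: "?I xs i \<in> words (insert c S) \<longleftrightarrow> ?C xs i" if "xs \<in> words S" for xs i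
  proof -
    have "set (take i xs) \<union> set (drop i xs) = set xs"
      by (metis append_take_drop_id set_append)
    then show ?thesis
    using that assms(2) successively_insert_iff[of "take i xs" "drop i xs" c]
    by (auto simp: words_def set_take_disj_set_drop_if_distinct dest: in_set_takeD in_set_dropD)
  qed
  have "(\<Sum>w\<in>words (insert c S). h w) = (\<Sum>p\<in>?P. h (case p of (xs, i) \<Rightarrow> ?I xs i))"
  proof (rule sum.reindex_bij_witness[where
      i = "\<lambda>(xs, i). ?I xs i" and
      j = "\<lambda>w. (takeWhile (\<lambda>x. x \<noteq> c) w @ tl (dropWhile (\<lambda>x. x \<noteq> c) w), length (takeWhile (\<lambda>x. x \<noteq> c) w))"])
    fix w assume w: "w \<in> words (insert c S)"
    then have "c \<in> set w" by (simp add: words_def)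
    then obtain us vs where uv: "w = us @ c # vs" "c \<notin> set us"
      by (meson split_list_first)
    have tw: "takeWhile (\<lambda>x. x \<noteq> c) w = us" "dropWhile (\<lambda>x. x \<noteq> c) w = c # vs"
      using split_at_first uv by simp_all
    show "(case (takeWhile (\<lambda>x. x \<noteq> c) w @ tl (dropWhile (\<lambda>x. x \<noteq> c) w), length (takeWhile (\<lambda>x. x \<noteq> c) w)) of
      (xs, i) \<Rightarrow> ?I xs i) = w" by (simp add: tw) (simp add: uv)
    then show "h (case (takeWhile (\<lambda>x. x \<noteq> c) w @ tl (dropWhile (\<lambda>x. x \<noteq> c) w), length (takeWhile (\<lambda>x. x \<noteq> c) w)) of
      (xs, i) \<Rightarrow> ?I xs i) = h w" by simp
    have r: "us @ vs \<in> words S" using remove w uv by simp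
    have "?I (us @ vs) (length us) = w" by (simp add: uv)
    then have "?C (us @ vs) (length us)" using I[OF r, of "length us"] w by simp
    then show "(takeWhile (\<lambda>x. x \<noteq> c) w @ tl (dropWhile (\<lambda>x. x \<noteq> c) w), length (takeWhile (\<lambda>x. x \<noteq> c) w)) \<in> ?P"
      using r by (auto simp: tw)
  next
    fix p assume p: "p \<in> ?P"
    obtain xs i where xi: "p = (xs, i)" by force
    have x: "xs \<in> words S" "i \<le> length xs" "?C xs i" using p xi by auto
    have cn: "c \<notin> set (take i xs)" using x(1) assms(2) by (auto simp: words_def dest: in_set_takeD)
    show "(case p of (xs, i) \<Rightarrow> ?I xs i) \<in> words (insert c S)" using I[OF x(1)] x(3) xi by simp
    have tw: "takeWhile (\<lambda>x. x \<noteq> c) (?I xs i) = take i xs" "dropWhile (\<lambda>x. x \<noteq> c) (?I xs i) = c # drop i xs"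
      using split_at_first[OF cn] by simp_all
    show "(takeWhile (\<lambda>x. x \<noteq> c) (case p of (xs, i) \<Rightarrow> ?I xs i) @ tl (dropWhile (\<lambda>x. x \<noteq> c) (case p of (xs, i) \<Rightarrow> ?I xs i)),
          length (takeWhile (\<lambda>x. x \<noteq> c) (case p of (xs, i) \<Rightarrow> ?I xs i))) = p"
      using x(2) by (simp add: xi tw)
  qed
  also have "\<dots> = (\<Sum>xs\<in>words S. \<Sum>i\<in>{i. i \<le> length xs \<and> ?C xs i}. h (?I xs i))"
    using finite_words[OF assms(1)] by (subst sum.Sigma) (auto simp: split_beta)
  also have "\<dots> = (\<Sum>xs\<in>words S. \<Sum>i\<le>length xs. if ?C xs i then h (?I xs i) else 0)"
  proof (rule sum.cong[OF refl])
    fix xs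
    have "{i. i \<le> length xs \<and> ?C xs i} = {i \<in> {..length xs}. ?C xs i}" by auto
    then show "(\<Sum>i\<in>{i. i \<le> length xs \<and> ?C xs i}. h (?I xs i)) = (\<Sum>i\<le>length xs. if ?C xs i then h (?I xs i) else 0)"
      by (simp only: sum.inter_filter[OF finite_atMost])
  qed
  finally show ?thesis .
qed

text \<open>As \<open>c\<close> is eligible for no car that is already present, all old
  contributions persist and \<open>c\<close> only adds its own.\<close>

lemma word_dinv_insert:
  assumes "distinct (us @ vs)" "c \<notin> set (us @ vs)" "\<And>e. e \<in> set (us @ vs) \<Longrightarrow> c \<notin> elig e"
  shows "word_dinv (us @ c # vs) = word_dinv (us @ vs) +
    (if c \<in> M then length (filter (\<lambda>e. e \<in> elig c) us) - 1 else length (filter (\<lambda>e. e \<in> elig c) vs))"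
proof -
  have len: "card (set ys \<inter> elig c) = length (filter (\<lambda>e. e \<in> elig c) ys)" if "distinct ys" for ys
    using distinct_card[of "filter (\<lambda>e. e \<in> elig c) ys"] that
    by (simp add: Int_def)
  have "word_dinv (us @ c # vs) = car_dinv (us @ c # vs) c + (\<Sum>e\<in>set (us @ vs). car_dinv (us @ c # vs) e)"
    using assms(2) by (simp add: word_dinv_def)
  also have "(\<Sum>e\<in>set (us @ vs). car_dinv (us @ c # vs) e) = (\<Sum>e\<in>set (us @ vs). car_dinv (us @ vs) e)"
    using assms by (intro sum.cong refl car_dinv_remove) auto
  finally show ?thesis
    using assms(1,2) by (simp add: car_dinv_insert word_dinv_def len)
qed

lemma words_remove:
  assumes "us @ c # vs \<in> words (insert c S)" "c \<notin> S"
    "\<And>p x. p \<in> insert 0 S \<Longrightarrow> x \<in> S \<Longrightarrow> adj p c \<Longrightarrow> adj c x \<Longrightarrow> adj p x"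
  shows "us @ vs \<in> words S"
proof -
  have S: "set us \<union> set vs = S" using assms(1,2) by (auto simp: words_def)
  have "last (0 # us) \<in> insert 0 S" using S by (auto simp: last_in_set)
  moreover have "vs \<noteq> [] \<Longrightarrow> hd vs \<in> S" using S by auto
  ultimately have "successively adj (0 # us @ vs)"
    using assms(1,3) by (intro successively_remove[of adj 0 us c vs]) (simp_all add: words_def)
  then show ?thesis using assms(1) S by (simp add: words_def)
qed

lemma length_filter_words:
  "xs \<in> words S \<Longrightarrow> length (filter (\<lambda>e. e \<in> A) xs) = card (A \<inter> S)"
  using distinct_card[of "filter (\<lambda>e. e \<in> A) xs"] by (auto simp: words_def Int_def conj_commute)

text \<open>By \<open>top\<close>, every car of \<open>S\<close> may follow \<open>c\<close>, while
  \<open>c\<close> may follow exactly the eligible letters. So the places for \<open>c\<close> are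
  those behind eligible letters, and the gain is the number of eligible cars to the right.\<close>

lemma sum_words_insert_unmarked:
  fixes q :: "'b::comm_semiring_1"
  assumes "finite S" "c \<notin> S" "0 \<notin> S" "c \<notin> M" "S \<inter> M = {}" "lev c > 0"
    and top: "\<And>x. x \<in> S \<Longrightarrow> lev x < lev c \<or> lev x = lev c \<and> c < x"
  shows "(\<Sum>w\<in>words (insert c S). q ^ word_dinv w) =
    q_number q (card (elig c \<inter> insert 0 S)) * (\<Sum>xs\<in>words S. q ^ word_dinv xs)"
proof -
  have pos: "0 < c" using assms(6) lev_0 by (cases c) auto
  let ?E = "\<lambda>e. e \<in> elig c"
  have trans: "adj p x" if "p \<in> insert 0 S" "x \<in> S" "adj p c" "adj c x" for p x
    using that top[of p] top[of x] assms(3-6) lev_0 unmarked_0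
    by (auto simp: adj_def split: if_splits)
  have rem: "us @ vs \<in> words S" if "us @ c # vs \<in> words (insert c S)" for us vs
    using words_remove[OF that assms(2)] trans by blast
  have "(\<Sum>w\<in>words (insert c S). q ^ word_dinv w) = (\<Sum>xs\<in>words S. \<Sum>i\<le>length xs.
    if adj (last (0 # take i xs)) c \<and> (drop i xs = [] \<or> adj c (hd (drop i xs)))
    then q ^ word_dinv (take i xs @ c # drop i xs) else 0)"
    by (rule sum_words_insert[OF assms(1,2) rem])
  also have "\<dots> = (\<Sum>xs\<in>words S. q_number q (card (elig c \<inter> insert 0 S)) * q ^ word_dinv xs)"
  proof (rule sum.cong[OF refl])
    fix xs assume xs: "xs \<in> words S"
    have cond: "(adj (last (0 # take i xs)) c \<and> (drop i xs = [] \<or> adj c (hd (drop i xs)))) \<longleftrightarrow> ?E (last (0 # take i xs))" for i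
    proof -
      have "last (0 # take i xs) \<in> insert 0 S"
        using xs in_set_takeD[OF last_in_set, of i xs] by (auto simp: words_def)
      moreover have "hd (drop i xs) \<in> S" if "drop i xs \<noteq> []"
        using xs in_set_dropD[OF hd_in_set[OF that]] by (simp add: words_def)
      ultimately show ?thesis
        using top[of "last (0 # take i xs)"] top[of "hd (drop i xs)"] assms(3-6) lev_0 unmarked_0 pos
        by (auto simp: adj_def elig_def simp del: last.simps)
    qed
    have ins: "word_dinv (take i xs @ c # drop i xs) = word_dinv xs + length (filter ?E (drop i xs))" for i
    proof -
      have "c \<notin> elig e" if "e \<in> S" for e using top[OF that] that assms(5) by (auto simp: elig_def)
      then show ?thesis
        using word_dinv_insert[of "take i xs" "drop i xs" c] xs assms(2,4)
        unfolding append_take_drop_id by (simp add: words_def)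
    qed
    have "length (filter ?E (0 # xs)) = card (elig c \<inter> insert 0 S)"
      using length_filter_words[OF xs, of "elig c"] assms(1,3) by (simp add: Int_insert_right)
    then have "(\<Sum>i\<le>length xs. if ?E (last (0 # take i xs)) then q ^ word_dinv xs * q ^ length (filter ?E (drop i xs)) else 0)
       = q_number q (card (elig c \<inter> insert 0 S)) * q ^ word_dinv xs"
      unfolding sum_unmarked_gaps[where E = ?E and g = "\<lambda>k. q ^ word_dinv xs * q ^ k"]
      by (simp add: q_number_def flip: sum_distrib_left) (simp add: mult.commute)
    then show "(\<Sum>i\<le>length xs. if adj (last (0 # take i xs)) c \<and> (drop i xs = [] \<or> adj c (hd (drop i xs)))
        then q ^ word_dinv (take i xs @ c # drop i xs) else 0) =
      q_number q (card (elig c \<inter> insert 0 S)) * q ^ word_dinv xs"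
      unfolding cond ins power_add .
  qed
  finally show ?thesis by (simp add: sum_distrib_left)
qed

text \<open>A marked \<open>c\<close> can be inserted exactly between a high letter and one that is low or eligible.
  In a word one gets from low to high only at an eligible letter, so behind an eligible letter there
  come high letters, then low ones, until the next eligible letter: this leaves one place for \<open>c\<close>.\<close>

definition high :: "nat \<Rightarrow> nat \<Rightarrow> bool" where
  "high c x \<longleftrightarrow> lev c < lev x \<or> lev x = lev c \<and> x < c"

lemma adj_high:
  assumes "c \<in> M" "x \<noteq> c" "y \<noteq> c" "adj x y" "high c y"
  shows "high c x \<or> y \<in> elig c"
  using assms by (auto simp: adj_def high_def elig_def split: if_splits)

lemma adj_marked_iff: "c \<in> M \<Longrightarrow> p \<noteq> c \<Longrightarrow> adj p c \<longleftrightarrow> high c p"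
  by (auto simp: adj_def high_def)

lemma marked_adj_iff: "c \<in> M \<Longrightarrow> x \<noteq> c \<Longrightarrow> adj c x \<longleftrightarrow> \<not> high c x \<or> x \<in> elig c"
  by (auto simp: adj_def high_def elig_def)

lemma elig_high: "c \<in> M \<Longrightarrow> x \<in> elig c \<Longrightarrow> high c x"
  by (auto simp: elig_def high_def)

lemma successively_high:
  assumes "xs \<in> words S" "c \<notin> S" "c \<in> M"
  shows "successively (\<lambda>x y. high c y \<longrightarrow> high c x \<or> y \<in> elig c) (0 # xs)"
proof -
  have "c \<noteq> 0" using assms(3) unmarked_0 by metis
  have xs: "successively adj (0 # xs)" "set xs = S"
    using assms(1) by (auto simp: words_def)
  show ?thesis
  proof (rule successively_mono[OF xs(1)], intro impI)
    fix x y assume "x \<in> set (0 # xs)" "y \<in> set (0 # xs)" "adj x y" "high c y"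
    then show "high c x \<or> y \<in> elig c"
      using \<open>c \<noteq> 0\<close> assms(2) xs(2) by (intro adj_high[OF assms(3)]) auto
  qed
qed

text \<open>Each place for \<open>c\<close> is determined by the number of eligible cars to its
  left. As the front letter \<open>0\<close> is low, this number runs from one to the number of
  eligible cars; less one for the mark, the exponents start at zero.\<close>

lemma sum_words_insert_marked:
  fixes q :: "'b::comm_semiring_1"
  assumes "finite S" "c \<notin> S" "0 \<notin> S" "c \<in> M" "lev c > 0"
  shows "(\<Sum>w\<in>words (insert c S). q ^ word_dinv w) =
    q_number q (card (elig c \<inter> insert 0 S)) * (\<Sum>xs\<in>words S. q ^ word_dinv xs)"
proof -
  have pos: "0 < c" using assms(5) lev_0 by (cases c) auto
  let ?E = "\<lambda>e. e \<in> elig c"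
  have trans: "adj p x" if "p \<in> insert 0 S" "x \<in> S" "adj p c" "adj c x" for p x
    using that assms(4)
    by (auto simp: adj_def split: if_splits)
  have rem: "us @ vs \<in> words S" if "us @ c # vs \<in> words (insert c S)" for us vs
    using words_remove[OF that assms(2)] trans by blast
  have "(\<Sum>w\<in>words (insert c S). q ^ word_dinv w) = (\<Sum>xs\<in>words S. \<Sum>i\<le>length xs.
    if adj (last (0 # take i xs)) c \<and> (drop i xs = [] \<or> adj c (hd (drop i xs)))
    then q ^ word_dinv (take i xs @ c # drop i xs) else 0)"
    by (rule sum_words_insert[OF assms(1,2) rem])
  also have "\<dots> = (\<Sum>xs\<in>words S. q_number q (card (elig c \<inter> insert 0 S)) * q ^ word_dinv xs)"
  proof (rule sum.cong[OF refl])
    fix xs assume xs: "xs \<in> words S"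
    have cond: "(adj (last (0 # take i xs)) c \<and> (drop i xs = [] \<or> adj c (hd (drop i xs)))) \<longleftrightarrow>
      high c (last (0 # take i xs)) \<and> (drop i xs = [] \<or> \<not> high c (hd (drop i xs)) \<or> ?E (hd (drop i xs)))" for i
    proof -
      have "last (0 # take i xs) \<in> insert 0 S"
        using xs in_set_takeD[OF last_in_set, of i xs] by (auto simp: words_def)
      then have "last (0 # take i xs) \<noteq> c" using pos assms(2) by auto
      moreover have "hd (drop i xs) \<noteq> c" if "drop i xs \<noteq> []"
        using xs in_set_dropD[OF hd_in_set[OF that]] assms(2) by (auto simp: words_def)
      ultimately show ?thesis
        using adj_marked_iff marked_adj_iff assms(4) by blast
    qed
    \<comment> \<open>The summand \<open>0\<close> is the offset \<open>b\<close> of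
      \<open>sum_marked_gaps\<close>.\<close>
    have ins: "word_dinv (take i xs @ c # drop i xs) = word_dinv xs + (0 + length (filter ?E (take i xs)) - 1)" for i
    proof -
      have "c \<notin> elig e" for e using assms(4) by (auto simp: elig_def)
      then show ?thesis
        using word_dinv_insert[of "take i xs" "drop i xs" c] xs assms(2,4)
        unfolding append_take_drop_id by (simp add: words_def)
    qed
    have hi: "\<forall>x. ?E x \<longrightarrow> high c x" using elig_high[OF assms(4)] by blast
    have "0 \<notin> elig c" "\<not> high c 0" using assms(4,5) lev_0 by (auto simp: elig_def high_def)
    then have "length (filter ?E xs) = card (elig c \<inter> insert 0 S)"
      using length_filter_words[OF xs, of "elig c"] by simp
    moreover have "(\<Sum>k\<in>{1..N}. q ^ (k - 1)) = q_number q N" for N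
      unfolding q_number_def using sum.shift_bounds_cl_Suc_ivl[of "\<lambda>k. q ^ (k - 1)" 0]
      by (cases N) (simp_all add: atLeast0AtMost lessThan_Suc_atMost del: sum.cl_ivl_Suc sum.atMost_Suc)
    ultimately have "(\<Sum>i\<le>length xs. if high c (last (0 # take i xs)) \<and>
         (drop i xs = [] \<or> \<not> high c (hd (drop i xs)) \<or> ?E (hd (drop i xs)))
        then q ^ word_dinv xs * q ^ (0 + length (filter ?E (take i xs)) - 1) else 0)
       = q_number q (card (elig c \<inter> insert 0 S)) * q ^ word_dinv xs"
      using \<open>\<not> high c 0\<close>
      unfolding sum_marked_gaps[where E = ?E and H = "high c" and b = 0 and
          g = "\<lambda>k. q ^ word_dinv xs * q ^ (k - 1)",
          OF successively_high[OF xs assms(2,4)] hi]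
      by (simp flip: sum_distrib_left) (simp add: mult.commute)
    then show "(\<Sum>i\<le>length xs. if adj (last (0 # take i xs)) c \<and> (drop i xs = [] \<or> adj c (hd (drop i xs)))
        then q ^ word_dinv (take i xs @ c # drop i xs) else 0) =
      q_number q (card (elig c \<inter> insert 0 S)) * q ^ word_dinv xs"
      unfolding cond ins power_add .
  qed
  finally show ?thesis by (simp add: sum_distrib_left)
qed

text \<open>Induction removes the car that is inserted last: the smallest one on the highest
  level.\<close>

lemma sum_words_unmarked:
  fixes q :: "'b::comm_semiring_1"
  assumes "finite S" "\<And>c. c \<in> S \<Longrightarrow> lev c > 0" "S \<inter> M = {}"
  shows "(\<Sum>w\<in>words S. q ^ word_dinv w) = (\<Prod>c\<in>S. q_number q (card (elig c \<inter> insert 0 S)))"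
  using assms
proof (induction S rule: finite_psubset_induct)
  case (psubset S)
  show ?case
  proof (cases "S = {}")
    case True
    have "words {} = {[]}" by (auto simp: words_def)
    then show ?thesis using True by (simp add: word_dinv_def)
  next
    case False
    define T where "T = {x \<in> S. lev x = Max (lev ` S)}"
    have "Max (lev ` S) \<in> lev ` S" using False psubset.hyps(1) by simp
    then have T: "finite T" "T \<noteq> {}" using psubset.hyps(1) by (auto simp: T_def)
    define c where "c = Min T"
    have cT: "c \<in> T" and min: "\<And>x. x \<in> T \<Longrightarrow> c \<le> x" using T by (simp_all add: c_def)
    define S' where "S' = S - {c}"
    have S: "S = insert c S'" "c \<notin> S'" "finite S'" "S' \<subset> S" using cT psubset.hyps(1) by (auto simp: S'_def T_def)
    have zero: "0 \<notin> S" using psubset.prems(1)[of 0] lev_0 by auto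
    have top: "lev x < lev c \<or> lev x = lev c \<and> c < x" if "x \<in> S'" for x
    proof -
      have "lev x \<le> lev c" using that cT psubset.hyps(1) by (auto simp: T_def S'_def)
      moreover have "lev x = lev c \<Longrightarrow> c \<le> x" using that cT by (intro min) (auto simp: T_def S'_def)
      ultimately show ?thesis using that by (auto simp: S'_def)
    qed
    have cc: "c \<notin> M" "lev c > 0" using S psubset.prems by auto
    have "elig c \<inter> insert 0 S' = elig c \<inter> insert 0 S" using S by (auto simp: elig_def)
    \<comment> \<open>The car \<open>c\<close> is not eligible for any earlier one, so the factors
      of the earlier cars do not change.\<close>
    moreover have "elig e \<inter> insert 0 S' = elig e \<inter> insert 0 S" if "e \<in> S'" for e
      using top[OF that] that S psubset.prems(2) by (auto simp: elig_def)
    moreover have "(\<Sum>w\<in>words S'. q ^ word_dinv w) = (\<Prod>c\<in>S'. q_number q (card (elig c \<inter> insert 0 S')))"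
      using S psubset.prems by (intro psubset.IH) auto
    moreover have "(\<Sum>w\<in>words (insert c S'). q ^ word_dinv w) =
      q_number q (card (elig c \<inter> insert 0 S')) * (\<Sum>xs\<in>words S'. q ^ word_dinv xs)"
      using S psubset.prems cc top zero by (intro sum_words_insert_unmarked) auto
    ultimately show ?thesis using S(2,3) unfolding S(1) by simp
  qed
qed

text \<open>The marked cars are added one by one to the unmarked ones. A marked car is never
  eligible, so each factor may be taken over the full set.\<close>

lemma sum_words:
  fixes q :: "'b::comm_semiring_1"
  assumes "finite S" "\<And>c. c \<in> S \<Longrightarrow> lev c > 0"
  shows "(\<Sum>w\<in>words S. q ^ word_dinv w) = (\<Prod>c\<in>S. q_number q (card (elig c \<inter> insert 0 S)))"
proof -
  have zero: "0 \<notin> S" using assms(2)[of 0] lev_0 by auto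
  have "(\<Sum>w\<in>words (S - M \<union> N). q ^ word_dinv w) =
      (\<Prod>c\<in>S - M \<union> N. q_number q (card (elig c \<inter> insert 0 (S - M \<union> N))))"
    if "finite N" "N \<subseteq> S \<inter> M" for N
    using that
  proof (induction N rule: finite_induct)
    case empty
    show ?case using assms by (simp, intro sum_words_unmarked) auto
  next
    case (insert c N)
    let ?S = "S - M \<union> N"
    have c: "c \<in> M" "c \<notin> ?S" "lev c > 0" "finite ?S" "0 \<notin> ?S"
      using insert assms zero by auto
    have "elig e \<inter> insert 0 ?S = elig e \<inter> insert 0 (insert c ?S)" for e
      using c(1) by (auto simp: elig_def)
    then show ?case
      using sum_words_insert_marked[OF c(4,2,5,1,3), of q] insert c(2,4) by simp
  qed
  moreover have "S - M \<union> S \<inter> M = S" by blast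
  ultimately show ?thesis using assms(1) by (metis finite_Int order_refl)
qed

text \<open>The front letter \<open>0\<close> is low, and a word can become high only at an eligible
  letter; but the letter before \<open>c\<close> must be high.\<close>

lemma marked_has_elig_before:
  assumes "us @ c # vs \<in> words S" "c \<in> M" "lev c > 0"
  shows "set us \<inter> elig c \<noteq> {}"
proof
  assume no: "set us \<inter> elig c = {}"
  have cnu: "c \<notin> set us" using assms(1) by (auto simp: words_def)
  have c0: "c \<noteq> 0" using assms(2) unmarked_0 by metis
  have suc: "successively adj (0 # us)" "adj (last (0 # us)) c"
    using assms(1) successively_append_iff[of adj "0 # us" "c # vs"] by (auto simp: words_def)
  have "\<not> high c 0" using lev_0 assms(3) by (auto simp: high_def)
  \<comment> \<open>The front letter is generalised from \<open>0\<close> to any low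
    \<open>z\<close> for the induction along \<open>us\<close>.\<close>
  then have "\<not> high c (last (z # us))" if "\<not> high c z" "z \<noteq> c" "successively adj (z # us)" for z
    using that no cnu
  proof (induction us arbitrary: z)
    case (Cons x us)
    then have "\<not> high c x" using adj_high[OF assms(2), of z x] by auto
    then have "\<not> high c (last (x # us))" using Cons.prems by (intro Cons.IH) auto
    then show ?case by simp
  qed simp
  then have "\<not> high c (last (0 # us))" using \<open>\<not> high c 0\<close> c0 suc(1) by blast
  moreover have "last (0 # us) \<noteq> c" using c0 cnu by auto
  ultimately show False using suc(2) adj_marked_iff[OF assms(2)] by blast
qed

end

subsection \<open>Paths and rows\<close>

text \<open>A path starting in column \<open>x\<close> is encoded by the weakly increasing columns
  of its North steps, one per row.\<close>

fun cols :: "nat \<Rightarrow> step list \<Rightarrow> nat list" where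
  "cols x [] = []"
| "cols x (East # p) = cols (Suc x) p"
| "cols x (North # p) = x # cols x p"

text \<open>Inverse to \<open>cols x\<close> for paths that start in column \<open>x\<close> and end in column \<open>N\<close>.\<close>

fun path_of :: "nat \<Rightarrow> nat \<Rightarrow> nat list \<Rightarrow> step list" where
  "path_of x N [] = replicate (N - x) East"
| "path_of x N (a # as) = replicate (a - x) East @ North # path_of a N as"

lemma length_cols: "length (cols x p) = count_list p North"
  by (induction x p rule: cols.induct) auto

lemma cols_ge: "a \<in> set (cols x p) \<Longrightarrow> x \<le> a"
  by (induction x p rule: cols.induct) auto

lemma sorted_cols: "sorted (cols x p)"
  by (induction x p rule: cols.induct) (auto dest: cols_ge)

lemma cols_replicate: "cols x (replicate k East @ p) = cols (x + k) p"
  by (induction k arbitrary: x) auto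

lemma cols_path_of: "sorted (x # as) \<Longrightarrow> cols x (path_of x N as) = as"
proof (induction as arbitrary: x)
  case Nil
  show ?case using cols_replicate[of x "N - x" "[]"] by simp
qed (simp add: cols_replicate)

lemma path_of_East:
  "(\<And>a. a \<in> set as \<Longrightarrow> x < a) \<Longrightarrow> x < N \<Longrightarrow> path_of x N as = East # path_of (Suc x) N as"
  by (cases as) (simp_all flip: replicate_Suc add: Suc_diff_Suc)

lemma path_of_cols: "path_of x (x + count_list p East) (cols x p) = p"
proof (induction x p rule: cols.induct)
  case (2 x p)
  then show ?case using path_of_East[of "cols (Suc x) p" x "Suc x + count_list p East"] cols_ge
    by (fastforce simp: Suc_le_eq)
qed auto

lemma count_path_of:
  "sorted (x # as) \<Longrightarrow> x \<le> N \<Longrightarrow> (\<And>a. a \<in> set as \<Longrightarrow> a \<le> N) \<Longrightarrow>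
    count_list (path_of x N as) East = N - x \<and> count_list (path_of x N as) North = length as"
proof (induction as arbitrary: x)
  case Nil
  have "count_list (replicate k East) s = (if s = East then k else 0)" for k s
    by (induction k) auto
  then show ?case by simp
next
  case (Cons a as)
  have "count_list (replicate k East) s = (if s = East then k else 0)" for k s
    by (induction k) auto
  then show ?case using Cons.IH[of a] Cons.prems by auto
qed

text \<open>The excess of East over North steps is largest just before some North step or at the
  end, so only these points matter.\<close>

lemma weakly_above_iff:
  "(\<forall>k\<le>length p. x + count_list (take k p) East \<le> y + count_list (take k p) North) \<longleftrightarrow>
    x + count_list p East \<le> y + count_list p North \<and> (\<forall>j<length (cols x p). cols x p ! j \<le> y + j)"
proof (induction x p arbitrary: y rule: cols.induct)
  case (1 x)
  show ?case by simp
next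
  case (2 x p)
  have "(\<forall>k\<le>length (East # p). x + count_list (take k (East # p)) East \<le> y + count_list (take k (East # p)) North)
    \<longleftrightarrow> x \<le> y \<and> (\<forall>k\<le>length p. Suc x + count_list (take k p) East \<le> y + count_list (take k p) North)"
    by (simp add: All_less_Suc2 flip: less_Suc_eq_le)
  moreover have "Suc x \<le> y" if "\<forall>k\<le>length p. Suc x + count_list (take k p) East \<le> y + count_list (take k p) North"
    using that[rule_format, of 0] by simp
  ultimately show ?case using 2[of y] by auto
next
  case (3 x p)
  have "(\<forall>k\<le>length (North # p). x + count_list (take k (North # p)) East \<le> y + count_list (take k (North # p)) North)
    \<longleftrightarrow> x \<le> y \<and> (\<forall>k\<le>length p. x + count_list (take k p) East \<le> Suc y + count_list (take k p) North)"
    by (simp add: All_less_Suc2 flip: less_Suc_eq_le)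
  then show ?case using 3[of "Suc y"] by (auto simp: All_less_Suc2)
qed

lemma dyck_path_iff:
  "dyck_path n p \<longleftrightarrow> count_list p East = n \<and> count_list p North = n \<and> (\<forall>j<n. cols 0 p ! j \<le> j)"
  using weakly_above_iff[of p 0 0] by (auto simp: dyck_path_def point_at_def length_cols)

section \<open>North steps and their rows\<close>

lemma cols_at_North:
  assumes "k < length p" "p ! k = North"
  shows "count_list (take k p) North < length (cols x p)"
    "cols x p ! count_list (take k p) North = x + count_list (take k p) East"
proof -
  have "count_list (take k p) North < length (cols x p) \<and>
    cols x p ! count_list (take k p) North = x + count_list (take k p) East"
    using assms
  proof (induction x p arbitrary: k rule: cols.induct)
    case (2 x p)
    then show ?case by (cases k) fastforce+
  next
    case (3 x p)
    then show ?case by (cases k) fastforce+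
  qed simp
  then show "count_list (take k p) North < length (cols x p)"
    "cols x p ! count_list (take k p) North = x + count_list (take k p) East" by simp_all
qed

lemma point_at_North:
  assumes "k < length p" "p ! k = North"
  shows "snd (point_at p k) < length (cols 0 p)"
    "point_at p k = (cols 0 p ! snd (point_at p k), snd (point_at p k))"
  using cols_at_North[OF assms, of 0] by (simp_all add: point_at_def)

lemma point_at_Suc:
  "k < length p \<Longrightarrow> point_at p (Suc k) = (if p ! k = East then (Suc (fst (point_at p k)), snd (point_at p k))
     else (fst (point_at p k), Suc (snd (point_at p k))))"
  using step.exhaust[of "p ! k"] by (auto simp: point_at_def take_Suc_conv_app_nth)

lemma point_at_mono:
  assumes "k \<le> k'"
  shows "fst (point_at p k) \<le> fst (point_at p k')" "snd (point_at p k) \<le> snd (point_at p k')"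
proof -
  have "take k' p = take k p @ take (k' - k) (drop k p)"
    using take_add[of k "k' - k" p] assms by simp
  then show "fst (point_at p k) \<le> fst (point_at p k')" "snd (point_at p k) \<le> snd (point_at p k')"
    by (simp_all add: point_at_def)
qed

lemma North_at_row:
  "r < length (cols x p) \<Longrightarrow> \<exists>k<length p. p ! k = North \<and> count_list (take k p) North = r"
proof (induction x p arbitrary: r rule: cols.induct)
  case (2 x p)
  then obtain k where "k < length p" "p ! k = North" "count_list (take k p) North = r" by fastforce
  then show ?case by (intro exI[of _ "Suc k"]) auto
next
  case (3 x p)
  show ?case
  proof (cases r)
    case 0
    then show ?thesis by (intro exI[of _ 0]) auto
  next
    case (Suc r')
    with 3 obtain k where "k < length p" "p ! k = North" "count_list (take k p) North = r'" by fastforce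
    then show ?thesis using Suc by (intro exI[of _ "Suc k"]) auto
  qed
qed simp

text \<open>Lets marks, which sit at steps of the path, be exchanged for marked cars, which are
  found by row.\<close>

lemma bij_betw_row:
  "bij_betw (\<lambda>k. snd (point_at p k)) {k. k < length p \<and> p ! k = North} {..<length (cols 0 p)}"
proof (rule bij_betw_imageI)
  have less: "snd (point_at p k) < snd (point_at p k')" if "k < k'" "k < length p" "p ! k = North" for k k'
    using point_at_Suc[OF that(2)] that(3) point_at_mono(2)[of "Suc k" k' p] that(1) by simp
  show "inj_on (\<lambda>k. snd (point_at p k)) {k. k < length p \<and> p ! k = North}"
    by (rule linorder_inj_onI) (use less in fastforce)+
  show "(\<lambda>k. snd (point_at p k)) ` {k. k < length p \<and> p ! k = North} = {..<length (cols 0 p)}"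
    using point_at_North(1) North_at_row[of _ 0 p] by (fastforce simp: point_at_def image_iff)
qed

lemma mem_north_cells_iff: "(i, j) \<in> north_cells p \<longleftrightarrow> j < length (cols 0 p) \<and> i = cols 0 p ! j"
proof
  assume "(i, j) \<in> north_cells p"
  then obtain k where "k < length p" "p ! k = North" "point_at p k = (i, j)"
    by (auto simp: north_cells_def)
  then show "j < length (cols 0 p) \<and> i = cols 0 p ! j" using point_at_North[of k p] by simp
next
  assume j: "j < length (cols 0 p) \<and> i = cols 0 p ! j"
  then obtain k where "k < length p" "p ! k = North" "snd (point_at p k) = j"
    using North_at_row[of j 0 p] by (auto simp: point_at_def)
  then have "point_at p k = (i, j)" using point_at_North(2)[of k p] j by simp
  then show "(i, j) \<in> north_cells p"
    using \<open>k < length p\<close> \<open>p ! k = North\<close> by (auto simp: north_cells_def intro!: exI[of _ k])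
qed

lemma car_at_iff: "car_at p cs (i, j) c \<longleftrightarrow> j < length (cols 0 p) \<and> i = cols 0 p ! j \<and> c = cs ! j"
  by (simp add: car_at_def mem_north_cells_iff)

text \<open>The step before a North step is either an East step or the North step of the row below,
  in the same column. The lowest row of a Dyck path starts in column \<open>0\<close>, with no East
  step before it.\<close>

lemma East_before_North_iff:
  assumes "dyck_path n p" "Suc k < length p" "p ! Suc k = North"
  shows "p ! k = East \<longleftrightarrow> (\<exists>r. snd (point_at p (Suc k)) = Suc r \<and> cols 0 p ! r < cols 0 p ! Suc r)"
proof
  let ?r = "snd (point_at p (Suc k))"
  note pt = point_at_North[OF assms(2,3)]
  assume E: "p ! k = East"
  then have k: "Suc (fst (point_at p k)) = cols 0 p ! ?r" "snd (point_at p k) = ?r"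
    using point_at_Suc[of k p] assms(2) pt by (metis Suc_lessD fst_conv, simp)
  \<comment> \<open>The East step makes the column positive, so this is not row
    \<open>0\<close>.\<close>
  have "cols 0 p ! ?r \<le> ?r" using assms(1) pt(1) by (simp add: dyck_path_iff length_cols)
  then obtain r where r: "?r = Suc r" using k(1) by (cases ?r) auto
  obtain k' where k': "k' < length p" "p ! k' = North" "snd (point_at p k') = r"
    using North_at_row[of r 0 p] pt(1) r by (auto simp: point_at_def)
  have "k' \<le> k" using point_at_mono(2)[of k k' p] k' k r by (cases "k' \<le> k") auto
  then have "fst (point_at p k') \<le> fst (point_at p k)" by (rule point_at_mono)
  moreover have "fst (point_at p k') = cols 0 p ! r"
    using point_at_North(2)[OF k'(1,2)] k'(3) by (metis fst_conv)
  ultimately show "\<exists>r. ?r = Suc r \<and> cols 0 p ! r < cols 0 p ! Suc r" using k(1) r by auto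
next
  assume "\<exists>r. snd (point_at p (Suc k)) = Suc r \<and> cols 0 p ! r < cols 0 p ! Suc r"
  then obtain r where r: "snd (point_at p (Suc k)) = Suc r" "cols 0 p ! r < cols 0 p ! Suc r" by blast
  show "p ! k = East"
  proof (rule ccontr)
    assume nE: "p ! k \<noteq> East"
    then have N: "p ! k = North" using step.exhaust by blast
    have "point_at p (Suc k) = (cols 0 p ! Suc r, Suc r)" using point_at_North(2)[OF assms(2,3)] r by simp
    then have "point_at p k = (cols 0 p ! Suc r, r)"
      using point_at_Suc[of k p] nE assms(2) by (simp add: prod_eq_iff)
    then show False using point_at_North(2)[of k p] N assms(2) r(2) by simp
  qed
qed

text \<open>The cell below the East step lies in the row below, one column to the left of the North
  step. It holds a car only if row \<open>i\<close> has its North step there, that is, if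
  \<open>a ! r = Suc (a ! i)\<close>.\<close>

definition valley_row :: "nat list \<Rightarrow> nat list \<Rightarrow> nat \<Rightarrow> bool" where
  "valley_row a cs r \<longleftrightarrow> (\<exists>i. r = Suc i \<and> r < length a \<and> a ! i < a ! r \<and> (a ! r = Suc (a ! i) \<longrightarrow> cs ! i < cs ! r))"

lemma mem_valleys_iff:
  assumes "dyck_path n p"
  shows "k \<in> valleys p cs \<longleftrightarrow> Suc k < length p \<and> p ! Suc k = North \<and>
    valley_row (cols 0 p) cs (snd (point_at p (Suc k)))"
proof (cases "Suc k < length p \<and> p ! Suc k = North")
  case True
  then have k: "Suc k < length p" "p ! Suc k = North" by auto
  note pt = point_at_North[OF k]
  note E = East_before_North_iff[OF assms k]
  let ?a = "cols 0 p"
  show ?thesis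
  proof (cases "p ! k = East")
    case True
    then obtain r where r: "snd (point_at p (Suc k)) = Suc r" "?a ! r < ?a ! Suc r" using E by blast
    have "point_at p k = (?a ! Suc r - 1, Suc r)"
      using point_at_Suc[of k p] True k(1) pt r by (simp add: prod_eq_iff)
    then show ?thesis using True k r pt(1)
      by (auto simp: valleys_def valley_row_def car_at_iff)
  next
    case False
    then show ?thesis using E by (auto simp: valleys_def valley_row_def)
  qed
qed (auto simp: valleys_def)

text \<open>The columns weakly increase with the row, so the cars of one column fill consecutive
  rows and comparing neighbours suffices.\<close>

lemma parking_function_iff:
  "parking_function n p cs \<longleftrightarrow> dyck_path n p \<and> length cs = n \<and> distinct cs \<and> set cs = {1..n} \<and>
    (\<forall>j. Suc j < n \<and> cols 0 p ! j = cols 0 p ! Suc j \<longrightarrow> cs ! j < cs ! Suc j)"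
proof -
  let ?a = "cols 0 p"
  have "(\<forall>i j j' c c'. car_at p cs (i, j) c \<and> car_at p cs (i, j') c' \<and> j < j' \<longrightarrow> c < c') \<longleftrightarrow>
    (\<forall>j. Suc j < n \<and> cols 0 p ! j = cols 0 p ! Suc j \<longrightarrow> cs ! j < cs ! Suc j)" (is "?L \<longleftrightarrow> ?R")
    if "dyck_path n p"
  proof
    have n: "length ?a = n" using that by (simp add: dyck_path_iff length_cols)
    assume ?L then show ?R by (auto simp: car_at_iff n)
  next
    have n: "length ?a = n" using that by (simp add: dyck_path_iff length_cols)
    assume R: ?R
    have "cs ! j < cs ! (j + Suc m)" if "j + Suc m < n" "?a ! j = ?a ! (j + Suc m)" for j m
      using that
    proof (induction m)
      case 0
      then show ?case using R by simp
    next
      case (Suc m)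
      \<comment> \<open>The columns at both ends agree, so all columns in between are equal.\<close>
      have "?a ! j \<le> ?a ! (j + Suc m)" "?a ! (j + Suc m) \<le> ?a ! (j + Suc (Suc m))"
        using Suc.prems(1) n by (auto intro!: sorted_nth_mono[OF sorted_cols])
      then have "?a ! j = ?a ! (j + Suc m)" "?a ! (j + Suc m) = ?a ! Suc (j + Suc m)"
        using Suc.prems by auto
      then show ?case using Suc R[rule_format, of "j + Suc m"] by force
    qed
    moreover have "j' = j + Suc (j' - j - 1)" if "j < j'" for j j' using that by simp
    ultimately show ?L unfolding car_at_iff n by metis
  qed
  then show ?thesis by (auto simp: parking_function_def)
qed

text \<open>A marked parking function read row by row: columns \<open>a\<close>, cars
  \<open>cs\<close>, and the marks as a set of cars instead of positions in the path.\<close>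

definition valid_rows :: "nat \<Rightarrow> nat list \<Rightarrow> nat list \<Rightarrow> nat set \<Rightarrow> bool" where
  "valid_rows n a cs M \<longleftrightarrow> length a = n \<and> sorted a \<and> (\<forall>j<n. a ! j \<le> j) \<and>
    length cs = n \<and> distinct cs \<and> set cs = {1..n} \<and>
    (\<forall>j. Suc j < n \<and> a ! j = a ! Suc j \<longrightarrow> cs ! j < cs ! Suc j) \<and>
    (\<forall>j<n. cs ! j \<in> M \<longrightarrow> valley_row a cs j) \<and> M \<subseteq> {1..n}"

definition mpf_of :: "nat \<Rightarrow> nat list \<Rightarrow> nat list \<Rightarrow> nat set \<Rightarrow> mpf" where
  "mpf_of n a cs M = \<lparr>mpf_path = path_of 0 n a, mpf_cars = cs,
     mpf_marks = {k. Suc k < length (path_of 0 n a) \<and> path_of 0 n a ! Suc k = North \<and>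
       cs ! snd (point_at (path_of 0 n a) (Suc k)) \<in> M}\<rparr>"

abbreviation mpf_cols :: "mpf \<Rightarrow> nat list" where
  "mpf_cols P \<equiv> cols 0 (mpf_path P)"

text \<open>The car of a mark is found from the row of its North step. Distinct North steps have
  distinct rows and hence distinct cars, so marks and marked cars correspond.\<close>

lemma marked_cars_eq:
  assumes "marked_parking_function n P"
  shows "marked_cars P = (\<lambda>k. mpf_cars P ! snd (point_at (mpf_path P) (Suc k))) ` mpf_marks P"
    "inj_on (\<lambda>k. mpf_cars P ! snd (point_at (mpf_path P) (Suc k))) {k. Suc k < length (mpf_path P) \<and> mpf_path P ! Suc k = North}"
    "mpf_marks P \<subseteq> {k. Suc k < length (mpf_path P) \<and> mpf_path P ! Suc k = North}"
proof -
  let ?p = "mpf_path P" and ?cs = "mpf_cars P"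
  let ?N = "{k. Suc k < length ?p \<and> ?p ! Suc k = North}"
  show sub: "mpf_marks P \<subseteq> ?N"
    using assms by (auto simp: marked_parking_function_def valleys_def)
  have "mpf_car_at P (point_at ?p (Suc k)) c \<longleftrightarrow> c = ?cs ! snd (point_at ?p (Suc k))" if "k \<in> ?N" for k c
  proof -
    define r where "r = snd (point_at ?p (Suc k))"
    have "r < length (cols 0 ?p)" "point_at ?p (Suc k) = (cols 0 ?p ! r, r)"
      using that point_at_North[of "Suc k" ?p] by (simp_all add: r_def)
    then show ?thesis by (simp add: car_at_iff)
  qed
  then show "marked_cars P = (\<lambda>k. ?cs ! snd (point_at ?p (Suc k))) ` mpf_marks P"
    using sub unfolding marked_cars_def by blast
  have "distinct ?cs" "length ?cs = length (cols 0 ?p)"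
    using assms by (simp_all add: marked_parking_function_def parking_function_def dyck_path_iff length_cols)
  then show "inj_on (\<lambda>k. ?cs ! snd (point_at ?p (Suc k))) ?N"
    using point_at_North(1)[of _ ?p] bij_betw_imp_inj_on[OF bij_betw_row[of ?p]]
    by (auto simp: inj_on_def nth_eq_iff_index_eq)
qed

lemma card_marked_cars:
  assumes "marked_parking_function n P"
  shows "card (marked_cars P) = card (mpf_marks P)"
  unfolding marked_cars_eq(1)[OF assms]
  by (rule card_image, rule inj_on_subset, rule marked_cars_eq(2)[OF assms], rule marked_cars_eq(3)[OF assms])

text \<open>Together with \<open>mpf_of_valid_rows\<close> this makes marked parking functions and
  row data interchangeable.\<close>

lemma valid_rows_of_mpf:
  assumes "marked_parking_function n P"
  shows "valid_rows n (mpf_cols P) (mpf_cars P) (marked_cars P)"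
    and "mpf_of n (mpf_cols P) (mpf_cars P) (marked_cars P) = P"
proof -
  let ?p = "mpf_path P" and ?cs = "mpf_cars P"
  have pf: "parking_function n ?p ?cs" and mv: "mpf_marks P \<subseteq> valleys ?p ?cs"
    using assms by (auto simp: marked_parking_function_def)
  then have d: "dyck_path n ?p" and cs: "length ?cs = n" "distinct ?cs" "set ?cs = {1..n}"
    by (auto simp: parking_function_def)
  have len: "length (mpf_cols P) = n" using d by (simp add: dyck_path_iff length_cols)
  note mc = marked_cars_eq[OF assms]
  have rows: "snd (point_at ?p (Suc k)) < n \<and> valley_row (mpf_cols P) ?cs (snd (point_at ?p (Suc k)))" if "k \<in> mpf_marks P" for k
    using mv that mem_valleys_iff[OF d] by (auto simp: valley_row_def len)
  have "valley_row (mpf_cols P) ?cs j" if "j < n" "?cs ! j \<in> marked_cars P" for j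
  proof -
    obtain k where k: "k \<in> mpf_marks P" "?cs ! j = ?cs ! snd (point_at ?p (Suc k))"
      using \<open>?cs ! j \<in> marked_cars P\<close> mc(1) by auto
    then have "j = snd (point_at ?p (Suc k))" using rows[OF k(1)] that(1) cs by (simp add: nth_eq_iff_index_eq)
    then show ?thesis using rows k by blast
  qed
  moreover have "marked_cars P \<subseteq> {1..n}"
    unfolding mc(1) cs(3)[symmetric] using rows cs(1) by (auto intro: nth_mem)
  ultimately show "valid_rows n (mpf_cols P) ?cs (marked_cars P)"
    using pf d by (auto simp: valid_rows_def parking_function_iff len sorted_cols dyck_path_iff)
  have p: "path_of 0 n (mpf_cols P) = ?p" using path_of_cols[of 0 ?p] d by (simp add: dyck_path_iff)
  have "{k. Suc k < length ?p \<and> ?p ! Suc k = North \<and> ?cs ! snd (point_at ?p (Suc k)) \<in> marked_cars P} = mpf_marks P"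
    using mc(2,3) unfolding mc(1) by (auto simp: inj_on_def)
  then show "mpf_of n (mpf_cols P) ?cs (marked_cars P) = P" by (simp add: mpf_of_def p)
qed

lemma mpf_of_valid_rows:
  assumes "valid_rows n a cs M"
  shows "marked_parking_function n (mpf_of n a cs M)" "mpf_cols (mpf_of n a cs M) = a"
    "mpf_cars (mpf_of n a cs M) = cs" "marked_cars (mpf_of n a cs M) = M"
proof -
  let ?p = "path_of 0 n a"
  have v: "length a = n" "sorted a" "\<forall>j<n. a ! j \<le> j" "length cs = n" "distinct cs" "set cs = {1..n}"
    "\<forall>j<n. cs ! j \<in> M \<longrightarrow> valley_row a cs j" "M \<subseteq> {1..n}"
    using assms by (auto simp: valid_rows_def)
  show cs: "mpf_cars (mpf_of n a cs M) = cs" by (simp add: mpf_of_def)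
  have c: "cols 0 ?p = a" using v(2) by (simp add: cols_path_of)
  then show "mpf_cols (mpf_of n a cs M) = a" by (simp add: mpf_of_def)
  have "x \<le> n" if "x \<in> set a" for x using that v(1,3) by (fastforce simp: in_set_conv_nth)
  then have d: "dyck_path n ?p" using count_path_of[of 0 a n] v by (simp add: dyck_path_iff c)
  then have pf: "parking_function n ?p cs" using assms by (simp add: parking_function_iff valid_rows_def c)
  have marks: "mpf_marks (mpf_of n a cs M) = {k. Suc k < length ?p \<and> ?p ! Suc k = North \<and> cs ! snd (point_at ?p (Suc k)) \<in> M}"
    "mpf_path (mpf_of n a cs M) = ?p" by (simp_all add: mpf_of_def)
  have "mpf_marks (mpf_of n a cs M) \<subseteq> valleys ?p cs"
    unfolding marks using v(7) point_at_North(1)[of _ ?p] by (auto simp: mem_valleys_iff[OF d] c v(1))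
  then show mpf: "marked_parking_function n (mpf_of n a cs M)"
    using pf by (simp add: marked_parking_function_def cs marks)
  show "marked_cars (mpf_of n a cs M) = M"
  proof
    show "marked_cars (mpf_of n a cs M) \<subseteq> M"
      unfolding marked_cars_eq(1)[OF mpf] cs marks by auto
    show "M \<subseteq> marked_cars (mpf_of n a cs M)"
    proof
      fix c assume cM: "c \<in> M"
      then have "c \<in> set cs" using v by auto
      then obtain j where j: "j < n" "cs ! j = c" using v(4) by (auto simp: in_set_conv_nth)
      obtain k where k: "k < length ?p" "?p ! k = North" "snd (point_at ?p k) = j"
        using North_at_row[of j 0 ?p] j c v by (auto simp: point_at_def)
      \<comment> \<open>A valley row is not row \<open>0\<close>, so its North step has a
        predecessor in the path, which is where the mark sits.\<close>
      have "valley_row a cs j" using v(7) j cM by auto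
      then have "0 < k" using k(3) by (cases k) (auto simp: valley_row_def point_at_def)
      then obtain k' where "k = Suc k'" by (cases k) auto
      then show "c \<in> marked_cars (mpf_of n a cs M)"
        unfolding marked_cars_eq(1)[OF mpf] cs marks using k j cM by (auto intro!: image_eqI[of _ _ k'])
    qed
  qed
qed

subsection \<open>Parking functions as words\<close>

lemma mpf_car_at_iff: "mpf_car_at P x c \<longleftrightarrow>
    snd x < length (mpf_cols P) \<and> fst x = mpf_cols P ! snd x \<and> c = mpf_cars P ! snd x"
  using car_at_iff[of "mpf_path P" "mpf_cars P" "fst x" "snd x" c] by simp

lemma diagonal_cars_eq:
  assumes "valid_rows n (mpf_cols P) (mpf_cars P) M"
  shows "diagonal_cars P d = {mpf_cars P ! j | j. j < n \<and> j - mpf_cols P ! j = d}"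
proof -
  have a: "length (mpf_cols P) = n" "\<And>j. j < n \<Longrightarrow> mpf_cols P ! j \<le> j"
    using assms by (auto simp: valid_rows_def)
  have "(\<exists>x. mpf_car_at P x c \<and> diagonal x = int d) \<longleftrightarrow> (\<exists>j. j < n \<and> c = mpf_cars P ! j \<and> j - mpf_cols P ! j = d)" for c
  proof -
    have "(\<exists>x. mpf_car_at P x c \<and> diagonal x = int d) \<longleftrightarrow>
      (\<exists>j. j < n \<and> c = mpf_cars P ! j \<and> int j - int (mpf_cols P ! j) = int d)"
      by (force simp: mpf_car_at_iff a(1) diagonal_def)
    also have "\<dots> \<longleftrightarrow> (\<exists>j. j < n \<and> c = mpf_cars P ! j \<and> j - mpf_cols P ! j = d)"
      using a(2) by (auto simp flip: of_nat_diff)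
    finally show ?thesis .
  qed
  then show ?thesis unfolding diagonal_cars_def by blast
qed

text \<open>Row \<open>y\<close> contributes the cells from its North step to the line, in the
  columns from \<open>mpf_cols P ! y\<close> to \<open>y - 1\<close>.\<close>

lemma mpf_area_eq:
  assumes "valid_rows n (mpf_cols P) (mpf_cars P) M"
  shows "mpf_area P = (\<Sum>j<n. j - mpf_cols P ! j)"
proof -
  let ?a = "mpf_cols P"
  have a: "length ?a = n" using assms by (auto simp: valid_rows_def)
  have "{(x, y). (\<exists>i\<le>x. (i, y) \<in> north_cells (mpf_path P)) \<and> x + 1 \<le> y} =
    (\<lambda>(y, x). (x, y)) ` (SIGMA y:{..<n}. {?a ! y..<y})"
    by (auto simp: mem_north_cells_iff a image_iff)
  moreover have "inj_on (\<lambda>(y, x). (x, y)) (SIGMA y:{..<n}. {?a ! y..<y})" by (auto simp: inj_on_def)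
  ultimately show ?thesis by (simp add: mpf_area_def card_image)
qed

section \<open>Words and inversions of parking functions with prescribed levels\<close>

context levelled_cars
begin

text \<open>From one row to the next the level rises by one if the column stays, is kept if the
  column grows by one, and falls if it grows by more. So \<open>adj\<close> restates the column
  condition and the valley condition.\<close>

lemma words_of_valid_rows:
  assumes v: "valid_rows n a cs M" and lev: "\<And>j. j < n \<Longrightarrow> lev (cs ! j) = Suc (j - a ! j)"
  shows "cs \<in> words {1..n}"
proof -
  have cs: "length cs = n" "distinct cs" "set cs = {1..n}" and a: "length a = n" "sorted a" "\<And>j. j < n \<Longrightarrow> a ! j \<le> j"
    using v by (auto simp: valid_rows_def)
  have "adj ((0 # cs) ! i) ((0 # cs) ! Suc i)" if "i < n" for i
  proof (cases i)
    case 0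
    \<comment> \<open>The lowest row is no valley row and has level \<open>1\<close>, so it may
      follow the fictitious car \<open>0\<close>.\<close>
    have "cs ! 0 \<notin> M" using v that 0 by (auto simp: valid_rows_def valley_row_def)
    moreover have "cs ! 0 \<in> {1..n}" using cs that 0 nth_mem by metis
    ultimately show ?thesis using lev[of 0] lev_0 that 0 by (simp add: adj_def)
  next
    case (Suc r)
    have "a ! r \<le> a ! Suc r" using sorted_nth_mono[OF a(2), of r "Suc r"] a(1) Suc that by simp
    moreover have "a ! r = a ! Suc r \<longrightarrow> cs ! r < cs ! Suc r"
      "cs ! Suc r \<in> M \<longrightarrow> a ! r < a ! Suc r \<and> (a ! Suc r = Suc (a ! r) \<longrightarrow> cs ! r < cs ! Suc r)"
      using v that Suc by (auto simp: valid_rows_def valley_row_def)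
    moreover have "a ! r \<le> r" "a ! Suc r \<le> Suc r" using a(3) Suc that by auto
    ultimately have "adj (cs ! r) (cs ! Suc r)"
      using lev[of r] lev[of "Suc r"] Suc that unfolding adj_def by (simp split: if_split) linarith
    then show ?thesis using Suc by simp
  qed
  then show ?thesis using cs by (simp add: words_def successively_conv_nth)
qed

text \<open>The converse of \<open>words_of_valid_rows\<close>: the column of row \<open>j\<close>
  is recovered from \<open>lev (cs ! j) = Suc (j - a ! j)\<close>.\<close>

lemma valid_rows_of_words:
  fixes cs n
  defines "a \<equiv> map (\<lambda>j. Suc j - lev (cs ! j)) [0..<n]"
  assumes cs: "cs \<in> words {1..n}" and pos: "\<And>c. c \<in> {1..n} \<Longrightarrow> 0 < lev c" and M: "M \<subseteq> {1..n}"
  shows "valid_rows n a cs M" "\<And>j. j < n \<Longrightarrow> lev (cs ! j) = Suc (j - a ! j)"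
proof -
  have c: "distinct cs" "set cs = {1..n}" "successively adj (0 # cs)" using cs by (auto simp: words_def)
  then have len: "length cs = n" using distinct_card[of cs] by simp
  have pos': "0 < lev (cs ! j)" if "j < n" for j using pos c(2) len that nth_mem[of j cs] by metis
  have adj0: "adj 0 (cs ! 0)" if "0 < n" using successively_nth[OF c(3), of 0] len that by simp
  have adjS: "adj (cs ! j) (cs ! Suc j)" if "Suc j < n" for j
    using successively_nth[OF c(3), of "Suc j"] len that by simp
  \<comment> \<open>Levels start from \<open>0\<close> in front of the word and rise by at most one
    per row, so the subtraction in \<open>a\<close> does not truncate.\<close>
  have le: "lev (cs ! j) \<le> Suc j" if "j < n" for j
    using that
  proof (induction j)
    case 0
    then show ?case using adj0 lev_0 by (auto simp: adj_def split: if_splits)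
  next
    case (Suc j)
    then show ?case using adjS[of j] by (auto simp: adj_def split: if_splits)
  qed
  have nth: "a ! j = Suc j - lev (cs ! j)" if "j < n" for j using that by (simp add: a_def)
  show lev: "lev (cs ! j) = Suc (j - a ! j)" if "j < n" for j
    using nth[OF that] pos'[OF that] le[OF that] by simp
  have step: "a ! j \<le> a ! Suc j" "a ! j = a ! Suc j \<longrightarrow> cs ! j < cs ! Suc j"
    "cs ! Suc j \<in> M \<longrightarrow> valley_row a cs (Suc j)" if "Suc j < n" for j
    using adjS[OF that] nth[of j] nth[of "Suc j"] le[of j] le[of "Suc j"] that
    by (auto simp: adj_def valley_row_def a_def split: if_splits)
  have "cs ! 0 \<notin> M" if "0 < n" using adj0[OF that] lev_0 pos'[OF that] by (auto simp: adj_def)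
  then have "valley_row a cs j" if "j < n" "cs ! j \<in> M" for j
    using that step(3)[of "j - 1"] by (cases j) auto
  moreover have "length a = n" by (simp add: a_def)
  moreover have "a ! j \<le> j" if "j < n" for j using nth[OF that] pos'[OF that] by simp
  ultimately show "valid_rows n a cs M"
    using step M c len by (auto simp: valid_rows_def sorted_iff_nth_Suc)
qed

text \<open>The \<open>of_bool\<close> on the left gives back the one subtracted for a mark, exactly
  when that subtraction did not truncate.\<close>

lemma car_dinv_nth:
  assumes "distinct cs" "length cs = n" "j < n"
  shows "car_dinv cs (cs ! j) + of_bool (cs ! j \<in> M \<and> set (take j cs) \<inter> elig (cs ! j) \<noteq> {}) =
    (\<Sum>i<n. of_bool (cs ! i \<in> elig (cs ! j) \<and> (if cs ! j \<in> M then i < j else j < i)))"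
proof -
  let ?c = "cs ! j"
  have set_take: "set (take j cs) = (!) cs ` {..<j}"
    using assms by (simp add: nth_image lessThan_atLeast0)
  have set_drop: "set (drop (Suc j) cs) = (!) cs ` {Suc j..<n}"
  proof -
    have "set (drop (Suc j) cs) = set (map ((!) cs) [Suc j..<n])"
      using assms by (metis drop_map drop_upt add_0 map_nth)
    then show ?thesis by simp
  qed
  have inj: "inj_on ((!) cs) {..<n}" using assms by (auto simp: inj_on_def nth_eq_iff_index_eq)
  have crd: "card ((!) cs ` I \<inter> elig ?c) = (\<Sum>i<n. of_bool (cs ! i \<in> elig ?c \<and> i \<in> I))" if "I \<subseteq> {..<n}" for I
  proof -
    have "(!) cs ` I \<inter> elig ?c = (!) cs ` {i \<in> {..<n}. cs ! i \<in> elig ?c \<and> i \<in> I}" using that by auto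
    moreover have "inj_on ((!) cs) {i \<in> {..<n}. cs ! i \<in> elig ?c \<and> i \<in> I}"
      by (rule inj_on_subset[OF inj]) auto
    ultimately have "card ((!) cs ` I \<inter> elig ?c) = card {i \<in> {..<n}. cs ! i \<in> elig ?c \<and> i \<in> I}"
      by (simp only: card_image)
    then show ?thesis by (simp add: Int_def sum.If_cases of_bool_def)
  qed
  note tw = takeWhile_dropWhile_nth[OF assms(1), of j]
  show ?thesis
  proof (cases "?c \<in> M")
    case True
    have "(set (take j cs) \<inter> elig ?c \<noteq> {}) \<longleftrightarrow> 0 < card (set (take j cs) \<inter> elig ?c)" by (simp add: card_gt_0_iff)
    then have "car_dinv cs ?c + of_bool (?c \<in> M \<and> set (take j cs) \<inter> elig ?c \<noteq> {}) = card (set (take j cs) \<inter> elig ?c)"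
      using True tw assms by (auto simp: car_dinv_def)
    also have "\<dots> = (\<Sum>i<n. of_bool (cs ! i \<in> elig ?c \<and> i < j))"
      using crd[of "{..<j}"] assms(3) set_take by auto
    finally show ?thesis using True by simp
  next
    case False
    have "car_dinv cs ?c = card (set (drop (Suc j) cs) \<inter> elig ?c)"
      using False tw assms by (simp add: car_dinv_def tl_drop drop_Suc)
    also have "\<dots> = (\<Sum>i<n. of_bool (cs ! i \<in> elig ?c \<and> i \<in> {Suc j..<n}))"
      unfolding set_drop by (rule crd) auto
    also have "\<dots> = (\<Sum>i<n. of_bool (cs ! i \<in> elig ?c \<and> j < i))"
      by (intro sum.cong) auto
    finally show ?thesis using False by simp
  qed
qed

text \<open>Within a diagonal, and between neighbouring diagonals, being further left means being in
  a lower row, so inversions are pairs of positions in the word. Each is attributed to the car that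
  counts it in \<open>car_dinv\<close>, and the ones subtracted there add up to the number of
  marks.\<close>

lemma mpf_dinv_eq:
  assumes P: "marked_parking_function n P" "marked_cars P = M"
    and lev: "\<And>j. j < n \<Longrightarrow> lev (mpf_cars P ! j) = Suc (j - mpf_cols P ! j)"
  shows "mpf_dinv P = int (word_dinv (mpf_cars P))"
proof -
  let ?cs = "mpf_cars P" and ?a = "mpf_cols P"
  have v: "valid_rows n ?a ?cs M" using valid_rows_of_mpf(1)[OF P(1)] P(2) by simp
  have cs: "length ?cs = n" "distinct ?cs" "set ?cs = {1..n}" and a: "length ?a = n" "sorted ?a" "\<And>j. j < n \<Longrightarrow> ?a ! j \<le> j"
    and M: "M \<subseteq> {1..n}"
    using v by (auto simp: valid_rows_def)
  have w: "?cs \<in> words {1..n}" using v lev by (rule words_of_valid_rows)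
  have inj: "inj_on ((!) ?cs) {..<n}" using cs by (auto simp: inj_on_def nth_eq_iff_index_eq)
  have inj2: "inj_on (\<lambda>(i, j). (?cs ! i, ?cs ! j)) ({..<n} \<times> {..<n})"
    using inj by (auto simp: inj_on_def)
  \<comment> \<open>\<open>Q1\<close> and \<open>Q2\<close> are the primary and the secondary
    inversions as pairs of rows, the smaller car always being in row \<open>i\<close>.\<close>
  define Q1 where "Q1 i j \<longleftrightarrow> ?cs ! i < ?cs ! j \<and> ?cs ! i \<notin> M \<and> lev (?cs ! i) = lev (?cs ! j) \<and> i < j" for i j
  define Q2 where "Q2 i j \<longleftrightarrow> ?cs ! i < ?cs ! j \<and> ?cs ! j \<notin> M \<and> lev (?cs ! j) = Suc (lev (?cs ! i)) \<and> j < i" for i j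
  have crd: "card ((\<lambda>(i, j). (?cs ! i, ?cs ! j)) ` {(i, j) \<in> {..<n} \<times> {..<n}. Q i j}) = (\<Sum>i<n. \<Sum>j<n. of_bool (Q i j))" for Q
  proof -
    have "card ((\<lambda>(i, j). (?cs ! i, ?cs ! j)) ` {(i, j) \<in> {..<n} \<times> {..<n}. Q i j}) = card {(i, j) \<in> {..<n} \<times> {..<n}. Q i j}"
      by (rule card_image[OF inj_on_subset[OF inj2]]) auto
    also have "\<dots> = card (SIGMA i:{..<n}. {j \<in> {..<n}. Q i j})" by (rule arg_cong[of _ _ card]) auto
    also have "\<dots> = (\<Sum>i<n. \<Sum>j<n. of_bool (Q i j))" by (simp add: Int_def of_bool_def sum.If_cases)
    finally show ?thesis .
  qed
  have prim: "primary_dinv P = (\<lambda>(i, j). (?cs ! i, ?cs ! j)) ` {(i, j) \<in> {..<n} \<times> {..<n}. Q1 i j}"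
  proof -
    have "(\<exists>x y. mpf_car_at P x s \<and> mpf_car_at P y b \<and> diagonal x = diagonal y \<and> fst x < fst y) \<longleftrightarrow>
      (\<exists>i j. i < n \<and> j < n \<and> s = ?cs ! i \<and> b = ?cs ! j \<and> lev s = lev b \<and> i < j)" for s b
    proof -
      have "(\<exists>x y. mpf_car_at P x s \<and> mpf_car_at P y b \<and> diagonal x = diagonal y \<and> fst x < fst y) \<longleftrightarrow>
        (\<exists>i j. i < n \<and> j < n \<and> s = ?cs ! i \<and> b = ?cs ! j \<and> int i - int (?a ! i) = int j - int (?a ! j) \<and> ?a ! i < ?a ! j)"
        by (force simp: mpf_car_at_iff a(1) diagonal_def)
      also have "\<dots> \<longleftrightarrow> (\<exists>i j. i < n \<and> j < n \<and> s = ?cs ! i \<and> b = ?cs ! j \<and> lev s = lev b \<and> i < j)"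
      proof -
        have "(int i - int (?a ! i) = int j - int (?a ! j) \<and> ?a ! i < ?a ! j) \<longleftrightarrow>
          (lev (?cs ! i) = lev (?cs ! j) \<and> i < j)" if "i < n" "j < n" for i j
          using that a(3)[of i] a(3)[of j] lev[of i] lev[of j] by auto
        then show ?thesis by blast
      qed
      finally show ?thesis .
    qed
    then show ?thesis by (auto simp: primary_dinv_def P(2) Q1_def image_iff)
  qed
  have sec: "secondary_dinv P = (\<lambda>(i, j). (?cs ! i, ?cs ! j)) ` {(i, j) \<in> {..<n} \<times> {..<n}. Q2 i j}"
  proof -
    have "(\<exists>x y. mpf_car_at P x s \<and> mpf_car_at P y b \<and> diagonal y = diagonal x + 1 \<and> fst y < fst x) \<longleftrightarrow>
      (\<exists>i j. i < n \<and> j < n \<and> s = ?cs ! i \<and> b = ?cs ! j \<and> lev b = Suc (lev s) \<and> j < i)" for s b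
    proof -
      have "(\<exists>x y. mpf_car_at P x s \<and> mpf_car_at P y b \<and> diagonal y = diagonal x + 1 \<and> fst y < fst x) \<longleftrightarrow>
        (\<exists>i j. i < n \<and> j < n \<and> s = ?cs ! i \<and> b = ?cs ! j \<and> int j - int (?a ! j) = int i - int (?a ! i) + 1 \<and> ?a ! j < ?a ! i)"
        by (force simp: mpf_car_at_iff a(1) diagonal_def)
      also have "\<dots> \<longleftrightarrow> (\<exists>i j. i < n \<and> j < n \<and> s = ?cs ! i \<and> b = ?cs ! j \<and> lev b = Suc (lev s) \<and> j < i)"
      proof -
        have "(int j - int (?a ! j) = int i - int (?a ! i) + 1 \<and> ?a ! j < ?a ! i) \<longleftrightarrow>
          (lev (?cs ! j) = Suc (lev (?cs ! i)) \<and> j < i)" if "i < n" "j < n" for i j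
        \<comment> \<open>\<open>?a ! j < ?a ! i\<close> alone only gives \<open>j \<le> i\<close>;
          equality is excluded because the levels differ.\<close>
        proof (cases "i = j")
          case False
          then show ?thesis using that a(3)[of i] a(3)[of j] lev[of i] lev[of j] by auto
        qed simp
        then show ?thesis by blast
      qed
      finally show ?thesis .
    qed
    then show ?thesis by (auto simp: secondary_dinv_def P(2) Q2_def image_iff)
  qed
  \<comment> \<open>\<open>T i j\<close> says that rows \<open>i\<close> and \<open>j\<close> form
    an inversion attributed to row \<open>i\<close>.\<close>
  define T where "T i j \<longleftrightarrow> ?cs ! j \<in> elig (?cs ! i) \<and> (if ?cs ! i \<in> M then j < i else i < j)" for i j
  have T: "of_bool (T i j) = (of_bool (Q1 i j \<and> ?cs ! j \<notin> M) + of_bool (Q1 j i \<and> ?cs ! i \<in> M) +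
      of_bool (Q2 j i \<and> ?cs ! j \<notin> M) + of_bool (Q2 i j \<and> ?cs ! i \<in> M) :: nat)" for i j
    by (auto simp: T_def Q1_def Q2_def elig_def)
  \<comment> \<open>Inversions outside \<open>R\<close> are attributed to the other row, so their
    part of the double sum is transposed.\<close>
  have split: "(\<Sum>i<n. \<Sum>j<n. of_bool (Q i j)) = (\<Sum>i<n. \<Sum>j<n. of_bool (Q i j \<and> R i j)) + (\<Sum>i<n. \<Sum>j<n. of_bool (Q j i \<and> \<not> R j i) :: nat)" for Q R
  proof -
    have "(\<Sum>i<n. \<Sum>j<n. of_bool (Q i j)) = (\<Sum>i<n. \<Sum>j<n. of_bool (Q i j \<and> R i j) + (of_bool (Q i j \<and> \<not> R i j) :: nat))"
      by (intro sum.cong refl) auto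
    also have "\<dots> = (\<Sum>i<n. \<Sum>j<n. of_bool (Q i j \<and> R i j)) + (\<Sum>i<n. \<Sum>j<n. of_bool (Q i j \<and> \<not> R i j))"
      by (simp only: sum.distrib)
    also have "(\<Sum>i<n. \<Sum>j<n. of_bool (Q i j \<and> \<not> R i j)) = (\<Sum>i<n. \<Sum>j<n. of_bool (Q j i \<and> \<not> R j i) :: nat)"
      by (rule sum.swap)
    finally show ?thesis .
  qed
  have inv: "card (primary_dinv P) + card (secondary_dinv P) = (\<Sum>i<n. \<Sum>j<n. of_bool (T i j))"
    unfolding prim sec crd split[of Q1 "\<lambda>i j. ?cs ! j \<notin> M"] split[of Q2 "\<lambda>i j. ?cs ! i \<in> M"] T sum.distrib
    by simp
  have "(\<Sum>i<n. \<Sum>j<n. of_bool (T i j)) = (\<Sum>i<n. car_dinv ?cs (?cs ! i) + of_bool (?cs ! i \<in> M))"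
  proof (intro sum.cong refl)
    fix i assume "i \<in> {..<n}"
    then have i: "i < n" by simp
    \<comment> \<open>For a marked car the subtraction does not truncate, so exactly one is given
      back per mark.\<close>
    have "set (take i ?cs) \<inter> elig (?cs ! i) \<noteq> {}" if "?cs ! i \<in> M"
    proof (rule marked_has_elig_before)
      show "take i ?cs @ ?cs ! i # drop (Suc i) ?cs \<in> words {1..n}"
        using w i cs(1) by (simp flip: id_take_nth_drop)
    qed (use that lev i in auto)
    then have "(?cs ! i \<in> M \<and> set (take i ?cs) \<inter> elig (?cs ! i) \<noteq> {}) \<longleftrightarrow> ?cs ! i \<in> M" by blast
    then show "(\<Sum>j<n. of_bool (T i j)) = car_dinv ?cs (?cs ! i) + of_bool (?cs ! i \<in> M)"
      using car_dinv_nth[OF cs(2,1) i] unfolding T_def by (simp only:)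
  qed
  also have "\<dots> = (\<Sum>c\<in>{1..n}. car_dinv ?cs c + of_bool (c \<in> M))"
  proof -
    have "(!) ?cs ` {..<n} = {1..n}" using cs nth_image[of n ?cs] by (simp add: lessThan_atLeast0)
    then show ?thesis using sum.reindex[OF inj, of "\<lambda>c. car_dinv ?cs c + of_bool (c \<in> M)"] by simp
  qed
  also have "\<dots> = word_dinv ?cs + card M"
    using M by (simp add: sum.distrib word_dinv_def cs(3) of_bool_def sum.If_cases Int_absorb1)
  finally show ?thesis
    using inv card_marked_cars[OF P(1)] P(2) by (simp add: mpf_dinv_def)
qed

end

subsection \<open>Runs\<close>

lemma increasing_runs_eq_Nil_iff [simp]: "increasing_runs w = [] \<longleftrightarrow> w = []"
  by (induction w rule: increasing_runs.induct) (auto simp: Let_def)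

lemma Nil_notin_increasing_runs: "[] \<notin> set (increasing_runs w)"
proof (induction w rule: increasing_runs.induct)
  case (3 x y ys)
  then show ?case by (auto simp: Let_def dest: list.set_sel(2)[rotated])
qed auto

lemma concat_increasing_runs [simp]: "concat (increasing_runs w) = w"
proof (induction w rule: increasing_runs.induct)
  case (3 x y ys)
  then show ?case by (cases "increasing_runs (y # ys)") (auto simp: Let_def)
qed auto

lemma hd_hd_increasing_runs: "w \<noteq> [] \<Longrightarrow> hd (hd (increasing_runs w)) = hd w"
  by (induction w rule: increasing_runs.induct) (auto simp: Let_def)

lemma sorted_increasing_runs: "r \<in> set (increasing_runs w) \<Longrightarrow> sorted_wrt (<) (map fst r)"
proof (induction w arbitrary: r rule: increasing_runs.induct)
  case (3 x y ys)
  let ?R = "increasing_runs (y # ys)"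
  obtain r0 R where R: "?R = r0 # R" by (cases ?R) auto
  have "hd r0 = y" using hd_hd_increasing_runs[of "y # ys"] R by simp
  moreover have "r0 \<noteq> []" using Nil_notin_increasing_runs[of "y # ys"] R by auto
  ultimately obtain r1 where r0: "r0 = y # r1" by (cases r0) auto
  have s: "sorted_wrt (<) (map fst r')" if "r' \<in> set (r0 # R)" for r' using 3(1) that R by simp
  show ?case
  proof (cases "fst x < fst y")
    case True
    then have "r = x # r0 \<or> r \<in> set R" using 3(2) R by (simp add: Let_def)
    moreover have "\<forall>z\<in>set r0. fst x < fst z" using s[of r0] True r0 by fastforce
    ultimately show ?thesis using s[of r0] s[of r] by auto
  next
    case False
    then have "r = [x] \<or> r \<in> set (r0 # R)" using 3(2) R by (simp add: Let_def)
    then show ?thesis using s[of r] by auto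
  qed
qed auto

lemma increasing_runs_append:
  assumes "b \<noteq> []" "sorted_wrt (<) (map fst b)" "w \<noteq> [] \<Longrightarrow> \<not> fst (last b) < fst (hd w)"
  shows "increasing_runs (b @ w) = b # increasing_runs w"
  using assms
proof (induction b rule: list_nonempty_induct)
  case (single x)
  then show ?case by (cases w) (auto simp: Let_def)
next
  case (cons x b)
  then obtain y b' where b: "b = y # b'" by (cases b) auto
  have "increasing_runs (b @ w) = b # increasing_runs w" using cons by auto
  then show ?case using cons.prems(1) b by (simp add: Let_def)
qed

text \<open>Serves to recognise the diagonals of a parking function as the runs of its type.\<close>

lemma increasing_runs_concat:
  assumes "\<And>b. b \<in> set bs \<Longrightarrow> b \<noteq> [] \<and> sorted_wrt (<) (map fst b)"
    "successively (\<lambda>b b'. \<not> fst (last b) < fst (hd b')) bs"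
  shows "increasing_runs (concat bs) = bs"
  using assms
proof (induction bs)
  case (Cons b bs)
  have "\<not> fst (last b) < fst (hd (concat bs))" if ne: "concat bs \<noteq> []"
  proof -
    obtain b' bs' where bs: "bs = b' # bs'" using ne by (cases bs) auto
    then have "b' \<noteq> []" using Cons.prems(1) by auto
    then show ?thesis using Cons.prems(2) bs by simp
  qed
  moreover have "increasing_runs (concat bs) = bs" using Cons by (auto simp: successively_Cons)
  ultimately show ?case using Cons.prems(1)[of b] increasing_runs_append[of b "concat bs"] by simp
qed simp

lemma increasing_runs_snoc_0: "increasing_runs (w @ [(0, m)]) = increasing_runs w @ [[(0, m)]]"
proof (induction w rule: increasing_runs.induct)
  case (3 x y ys)
  then show ?case by (cases "increasing_runs (y # ys)") (auto simp: Let_def)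
qed (auto simp: Let_def)

definition run_index :: "(nat \<times> bool) list list \<Rightarrow> nat \<Rightarrow> nat" where
  "run_index R c = (THE k. k < length R \<and> c \<in> fst ` set (R ! k))"

text \<open>Runs are counted from the right because a type lists the diagonals from the highest
  down; an appended \<open>0\<close> then gets level \<open>0\<close>.\<close>

definition run_level :: "(nat \<times> bool) list list \<Rightarrow> nat \<Rightarrow> nat" where
  "run_level R c = length R - 1 - run_index R c"

lemma run_unique:
  assumes "distinct (map fst (concat R))" "k < length R" "k' < length R"
    "c \<in> fst ` set (R ! k)" "c \<in> fst ` set (R ! k')"
  shows "k = k'"
proof -
  have False if "i < j" "j < length R" "c \<in> fst ` set (R ! i)" "c \<in> fst ` set (R ! j)" for i j
  proof -
    have "R = take j R @ drop j R" "R ! i \<in> set (take j R)" "R ! j \<in> set (drop j R)"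
      using that by (auto simp: in_set_conv_nth intro: exI[of _ i] exI[of _ 0])
    then have "c \<in> fst ` set (concat (take j R))" "c \<in> fst ` set (concat (drop j R))"
      "distinct (map fst (concat (take j R)) @ map fst (concat (drop j R)))"
      using that(3,4) assms(1) by (force, force, metis concat_append map_append)
    then show False by auto
  qed
  then show ?thesis using assms by (metis nat_neq_iff)
qed

lemma run_index_eq:
  assumes "distinct (map fst (concat R))" "k < length R" "c \<in> fst ` set (R ! k)"
  shows "run_index R c = k"
  unfolding run_index_def using assms run_unique[OF assms(1)] by (intro the_equality) auto

lemma run_index_mem:
  assumes "distinct (map fst (concat R))" "c \<in> fst ` set (concat R)"
  shows "run_index R c < length R" "c \<in> fst ` set (R ! run_index R c)"
proof -
  obtain k where "k < length R" "c \<in> fst ` set (R ! k)"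
    using assms(2) by (force simp: in_set_conv_nth)
  then show "run_index R c < length R" "c \<in> fst ` set (R ! run_index R c)"
    using run_index_eq[OF assms(1)] by metis+
qed

text \<open>A new first letter moves every old descent one place to the right and may create a
  descent at position one, so each descent of the new word adds one.\<close>

lemma maj_Cons: "maj (x # w) = maj w + card {i. i < length w \<and> (x # w) ! i > (x # w) ! Suc i}"
proof -
  let ?D = "{i. i < length w \<and> (x # w) ! i > (x # w) ! Suc i}"
  have "maj (x # w) = (\<Sum>i\<in>?D. Suc i)"
    unfolding maj_def
    by (rule sum.reindex_bij_witness[of _ Suc "\<lambda>i. i - 1"]) (auto simp: Suc_le_eq nth_Cons')
  also have "\<dots> = (\<Sum>i\<in>?D. i) + card ?D" by (rule sum_Suc)
  also have "(\<Sum>i\<in>?D. i) = (\<Sum>i\<in>{i \<in> ?D. 1 \<le> i}. i)"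
    by (rule sum.mono_neutral_right) auto
  also have "\<dots> = maj w" unfolding maj_def by (rule sum.cong) (auto simp: nth_Cons')
  finally show ?thesis .
qed

lemma card_descents:
  assumes "distinct (map fst w)" "w \<noteq> []"
  shows "Suc (card {i. Suc i < length w \<and> map fst w ! i > map fst w ! Suc i}) = length (increasing_runs w)"
  using assms
proof (induction w rule: increasing_runs.induct)
  case (3 x y ys)
  let ?D = "\<lambda>w. {i. Suc i < length w \<and> map fst w ! i > map fst w ! Suc i}"
  have D: "?D (x # y # ys) = (if fst x > fst y then {0} else {}) \<union> Suc ` ?D (y # ys)" (is "?L = ?R")
  proof (rule set_eqI)
    fix i show "i \<in> ?L \<longleftrightarrow> i \<in> ?R" by (cases i) auto
  qed
  have "card (?D (x # y # ys)) = (if fst x > fst y then 1 else 0) + card (?D (y # ys))"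
    unfolding D by (subst card_Un_disjoint) (auto simp: card_image)
  moreover have "Suc (card (?D (y # ys))) = length (increasing_runs (y # ys))" using 3 by simp
  moreover have "fst x \<noteq> fst y" using 3(2) by simp
  ultimately show ?case by (cases "increasing_runs (y # ys)") (auto simp: Let_def)
qed auto

text \<open>A descent at position \<open>i\<close> stands for the \<open>i\<close> letters up to it.
  Counted by letters instead, each letter contributes the descents to its right, one for every run
  after its own.\<close>

lemma maj_eq_sum_runs:
  assumes "distinct (map fst w)"
  shows "maj (map fst w) = (\<Sum>k<length (increasing_runs w).
    (length (increasing_runs w) - 1 - k) * length (increasing_runs w ! k))"
  using assms
proof (induction w rule: increasing_runs.induct)
  case 1
  then show ?case by (simp add: maj_def)
next
  case (2 x)
  have "maj [fst x] = 0" unfolding maj_def by (rule sum.neutral) auto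
  then show ?case by simp
next
  case (3 x y ys)
  let ?w = "x # y # ys"
  obtain r R where R: "increasing_runs (y # ys) = r # R" by (cases "increasing_runs (y # ys)") auto
  have "maj (map fst ?w) = maj (map fst (y # ys)) + (length (increasing_runs ?w) - 1)"
    using maj_Cons[of "fst x" "map fst (y # ys)"] card_descents[of ?w] 3(2) by simp
  then show ?case using 3 R
    by (auto simp: Let_def sum.lessThan_Suc_shift simp del: sum.lessThan_Suc)
qed

lemma maj_eq_sum_run_level:
  assumes "distinct (map fst w)"
  shows "maj (map fst w) = (\<Sum>c\<in>fst ` set w. run_level (increasing_runs w) c)"
proof -
  let ?R = "increasing_runs w"
  have d: "distinct (map fst (concat ?R))" using assms by simp
  have "fst ` set w = (\<Union>k<length ?R. fst ` set (?R ! k))"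
  proof -
    have "fst ` set w = fst ` set (concat ?R)" by simp
    also have "\<dots> = (\<Union>k<length ?R. fst ` set (?R ! k))"
    proof -
      have R: "set ?R = (!) ?R ` {..<length ?R}" by (auto simp: set_conv_nth)
      show ?thesis unfolding set_concat R by (simp add: image_UN)
    qed
    finally show ?thesis .
  qed
  moreover have "(\<Sum>c\<in>(\<Union>k<length ?R. fst ` set (?R ! k)). run_level ?R c) =
      (\<Sum>k<length ?R. \<Sum>c\<in>fst ` set (?R ! k). run_level ?R c)"
    using run_unique[OF d] by (intro sum.UNION_disjoint) auto
  moreover have "(\<Sum>c\<in>fst ` set (?R ! k). run_level ?R c) = (length ?R - 1 - k) * length (?R ! k)" if "k < length ?R" for k
  proof -
    have "distinct (map fst (?R ! k))"
      using sorted_increasing_runs[of "?R ! k" w] that strict_sorted_iff by auto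
    then have "card (fst ` set (?R ! k)) = length (?R ! k)" using distinct_card by fastforce
    then show ?thesis using run_index_eq[OF d that] by (simp add: run_level_def)
  qed
  ultimately show ?thesis using maj_eq_sum_runs[OF assms] by simp
qed

text \<open>The appended \<open>0\<close> creates a descent behind the last letter of a nonempty
  \<open>w\<close>, which balances the shift by one between levels and diagonals.\<close>

lemma maj_snoc_0: "0 \<notin> set w \<Longrightarrow> maj (w @ [0]) = maj w + length w"
proof (cases "w = []")
  case False
  assume z: "0 \<notin> set w"
  have pos: "0 < w ! i" if "i < length w" for i using z nth_mem[OF that] by (metis gr0I)
  have "{i. 1 \<le> i \<and> i < length (w @ [0]) \<and> (w @ [0]) ! (i - 1) > (w @ [0]) ! i} =
    insert (length w) {i. 1 \<le> i \<and> i < length w \<and> w ! (i - 1) > w ! i}"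
    using False pos by (auto simp: nth_append Suc_le_eq)
  then show ?thesis by (simp add: maj_def)
next
  case True
  have "maj [0] = 0" "maj [] = 0" unfolding maj_def by (rule sum.neutral, auto)+
  then show ?thesis using True by simp
qed

section \<open>The word of an ordered set partition\<close>

lemma ordered_set_partition_Cons:
  assumes "ordered_set_partition A (B # Bs)"
  shows "ordered_set_partition (A - B) Bs" "B \<subseteq> A" "B \<noteq> {}"
proof -
  have p: "partition_on A (insert B (set Bs))" "B \<notin> set Bs" "distinct Bs"
    using assms by (auto simp: ordered_set_partition_def)
  show "B \<subseteq> A" "B \<noteq> {}" using p(1) by (auto simp: partition_on_def)
  have "\<Union> (set Bs) = A - B" using p(1,2) unfolding partition_on_def
    by (auto simp: disjoint_def)
  then show "ordered_set_partition (A - B) Bs"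
    using p by (auto simp: ordered_set_partition_def partition_on_def disjoint_def)
qed

lemma tau_ne_Nil:
  assumes "finite A" "ordered_set_partition A Bs" "Bs \<noteq> []"
  shows "tau Bs \<noteq> []"
  using assms
proof (induction Bs arbitrary: A rule: tau.induct)
  case (2 B)
  then have "finite B" "B \<noteq> {}" using ordered_set_partition_Cons(2,3)[of A B "[]"] finite_subset by blast+
  then show ?case by simp
next
  case (3 B B' Bs)
  then show ?case using ordered_set_partition_Cons[of A B "B' # Bs"] by (auto simp: Let_def)
qed auto

text \<open>The letter \<open>r\<close> that separates the two halves of \<open>B\<close> comes from
  a later block, so it is not in \<open>B\<close> and no element of \<open>B\<close> is
  lost.\<close>

lemma tau_Cons:
  assumes "finite A" "ordered_set_partition A (B # Bs)"
    and IH: "set (tau Bs) = A - B"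
  obtains u where "tau (B # Bs) = u @ tau Bs" "distinct u" "set u = B"
proof -
  note o = ordered_set_partition_Cons[OF assms(2)]
  have fB: "finite B" using assms(1) o(2) finite_subset by blast
  show ?thesis
  proof (cases Bs)
    case Nil
    then show ?thesis using that[of "sorted_list_of_set B"] fB by simp
  next
    case (Cons B' Bs')
    define r where "r = hd (tau Bs)"
    have "tau Bs \<noteq> []" using tau_ne_Nil[of "A - B" Bs] o(1) Cons assms(1) by simp
    then have "r \<notin> B" using IH hd_in_set[of "tau Bs"] by (auto simp: r_def)
    then have B: "{x \<in> B. x > r} \<union> {x \<in> B. x < r} = B" by (auto, metis nat_neq_iff)
    show ?thesis
    proof (rule that[of "sorted_list_of_set {x \<in> B. x > r} @ sorted_list_of_set {x \<in> B. x < r}"])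
      show "tau (B # Bs) = (sorted_list_of_set {x \<in> B. x > r} @ sorted_list_of_set {x \<in> B. x < r}) @ tau Bs"
        using Cons by (simp add: Let_def r_def)
      show "distinct (sorted_list_of_set {x \<in> B. x > r} @ sorted_list_of_set {x \<in> B. x < r})"
        using fB by auto
      have "set (sorted_list_of_set {x \<in> B. x > r} @ sorted_list_of_set {x \<in> B. x < r}) =
          {x \<in> B. x > r} \<union> {x \<in> B. x < r}"
        using fB by simp
      then show "set (sorted_list_of_set {x \<in> B. x > r} @ sorted_list_of_set {x \<in> B. x < r}) = B"
        using B by (rule trans)
    qed
  qed
qed

lemma tau_props:
  assumes "finite A" "ordered_set_partition A Bs"
  shows "set (tau Bs) = A \<and> distinct (tau Bs) \<and> map fst (tau_star Bs) = tau Bs"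
  using assms
proof (induction Bs arbitrary: A)
  case Nil
  then show ?case by (simp add: ordered_set_partition_def partition_on_def)
next
  case (Cons B Bs)
  note o = ordered_set_partition_Cons[OF Cons.prems(2)]
  have IH: "set (tau Bs) = A - B" "distinct (tau Bs)" "map fst (tau_star Bs) = tau Bs"
    using Cons.IH[OF _ o(1)] Cons.prems(1) by auto
  obtain u where u: "tau (B # Bs) = u @ tau Bs" "distinct u" "set u = B"
    using tau_Cons[OF Cons.prems IH(1)] by blast
  have "card B = length u" using distinct_card[OF u(2)] u(3) by simp
  moreover have "map fst (mark_tail v) = v" for v by (cases v) (auto simp: comp_def)
  ultimately show ?case using u o(2) IH by auto
qed

subsection \<open>Parking functions of a given type\<close>

lemma length_le_length_concat: "[] \<notin> set xss \<Longrightarrow> length xss \<le> length (concat xss)"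
proof (induction xss)
  case (Cons xs xss)
  then have "1 \<le> length xs" by (cases xs) auto
  then show ?case using Cons by simp
qed simp

lemma sorted_hd_last: "sorted xs \<Longrightarrow> x \<in> set xs \<Longrightarrow> hd xs \<le> x \<and> x \<le> last xs"
  by (induction xs) auto

lemma card_eq_add: "finite X \<Longrightarrow> X = Y \<union> Z \<Longrightarrow> Y \<inter> Z = {} \<Longrightarrow> card X = card Y + card Z"
  by (simp add: card_Un_disjoint)

text \<open>The type enters as any marked permutation of \<open>1..n\<close>;
  \<open>tau_star\<close> of an ordered set partition is the instance used in the end.\<close>

locale type_word =
  fixes n :: nat and ts :: "(nat \<times> bool) list"
  assumes dist: "distinct (map fst ts)" and letters: "fst ` set ts = {1..n}"
begin

section \<open>Levels read off from the runs, and schedule numbers\<close>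

abbreviation "R \<equiv> increasing_runs ts"
abbreviation "R0 \<equiv> increasing_runs (ts @ [(0, False)])"
abbreviation "lev \<equiv> run_level R0"
definition "M = {c. (c, True) \<in> set ts}"

lemma R0_eq: "R0 = R @ [[(0, False)]]"
  by (rule increasing_runs_snoc_0)

lemma dist0: "distinct (map fst (ts @ [(0, False)]))"
  using dist letters by auto

lemma dist_runs: "distinct (map fst (concat R0))"
  using dist0 by simp

lemma lev_eq: "k \<le> length R \<Longrightarrow> c \<in> fst ` set (R0 ! k) \<Longrightarrow> run_index R0 c = k \<and> lev c = length R - k"
  using run_index_eq[OF dist_runs, of k c] by (simp add: run_level_def R0_eq)

lemma lev_index:
  assumes "c \<le> n"
  shows "run_index R0 c \<le> length R" "c \<in> fst ` set (R0 ! run_index R0 c)" "lev c = length R - run_index R0 c"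
proof -
  have "c \<in> fst ` set (concat R0)" using assms letters by (cases "c = 0") auto
  from run_index_mem[OF dist_runs this]
  show "run_index R0 c \<le> length R" "c \<in> fst ` set (R0 ! run_index R0 c)" "lev c = length R - run_index R0 c"
    by (simp_all add: R0_eq run_level_def)
qed

lemma lev_zero: "lev 0 = 0"
  using lev_eq[of "length R" 0] by (simp add: R0_eq)

lemma lev_pos:
  assumes "c \<in> {1..n}"
  shows "0 < lev c" "run_index R0 c < length R"
proof -
  have "run_index R0 c \<noteq> length R" using lev_index(2)[of c] assms by (auto simp: R0_eq)
  then show "run_index R0 c < length R" "0 < lev c" using lev_index(1,3)[of c] assms by auto
qed

lemma M_subset: "M \<subseteq> {1..n}"
  using letters by (force simp: M_def)

lemma mark_iff: "(c, b) \<in> set (ts @ [(0, False)]) \<Longrightarrow> b \<longleftrightarrow> c \<in> M"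
proof -
  assume cb: "(c, b) \<in> set (ts @ [(0, False)])"
  show ?thesis
  proof (cases b)
    case True
    then show ?thesis using cb by (auto simp: M_def)
  next
    case False
    have "(c, True) \<notin> set (ts @ [(0, False)])"
      using eq_key_imp_eq_value[OF dist0, of c True False] cb False by auto
    then show ?thesis using False by (simp add: M_def)
  qed
qed

sublocale levelled_cars lev M
  using lev_zero M_subset by unfold_locales auto

text \<open>The dictionary between runs and levels; \<open>k = length R\<close> is the run of the
  appended \<open>0\<close>.\<close>

lemma unmarked_run:
  assumes "k \<le> length R"
  shows "{d. (d, False) \<in> set (R0 ! k)} = {d. d \<le> n \<and> d \<notin> M \<and> lev d = length R - k}"
proof (intro equalityI subsetI)
  fix d assume "d \<in> {d. (d, False) \<in> set (R0 ! k)}"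
  then have d: "(d, False) \<in> set (R0 ! k)" by simp
  have "R0 ! k \<in> set R0" using assms by (intro nth_mem) (simp add: R0_eq)
  then have "(d, False) \<in> set (concat R0)" unfolding set_concat using d by blast
  then have "(d, False) \<in> set (ts @ [(0, False)])" by simp
  moreover from this have "d \<le> n" using letters by force
  moreover have "d \<in> fst ` set (R0 ! k)" using d by force
  ultimately show "d \<in> {d. d \<le> n \<and> d \<notin> M \<and> lev d = length R - k}"
    using mark_iff[of d False] lev_eq[OF assms] by auto
next
  fix d assume "d \<in> {d. d \<le> n \<and> d \<notin> M \<and> lev d = length R - k}"
  then have d: "d \<le> n" "d \<notin> M" "lev d = length R - k" by auto
  then have k: "run_index R0 d = k" using lev_index(1,3)[OF d(1)] assms by simp
  then obtain b where b: "(d, b) \<in> set (R0 ! k)" using lev_index(2)[OF d(1)] by force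
  have "R0 ! k \<in> set R0" using assms by (intro nth_mem) (simp add: R0_eq)
  then have "(d, b) \<in> set (concat R0)" unfolding set_concat using b by blast
  then have "\<not> b" using mark_iff[of d b] d(2) by simp
  then show "d \<in> {d. (d, False) \<in> set (R0 ! k)}" using b by simp
qed

lemma run_level_le: "c \<le> n \<Longrightarrow> lev c \<le> length R"
  using lev_index(3) by simp

text \<open>The next run is one level lower. It always exists, since the appended \<open>0\<close>
  forms a run of its own.\<close>

lemma card_elig_unmarked:
  assumes "c \<in> {1..n}" "c \<notin> M" "k = run_index R0 c"
  shows "card (elig c \<inter> insert 0 {1..n}) = card {d \<in> {d. (d, False) \<in> set (R0 ! k)}. d > c} +
    card {d. Suc k < length R0 \<and> d \<in> {d. (d, False) \<in> set (R0 ! Suc k)} \<and> d < c}"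
proof -
  have k: "k < length R" "lev c = length R - k" using lev_pos[OF assms(1)] lev_index(3)[of c] assms by auto
  have len: "Suc k < length R0" using k(1) by (simp add: R0_eq)
  have below: "Suc (lev d) = lev c \<longleftrightarrow> lev d = length R - Suc k" for d using k by auto
  have "elig c \<inter> insert 0 {1..n} = {d. d \<le> n \<and> d \<notin> M \<and> lev d = lev c \<and> c < d} \<union>
      {d. d \<le> n \<and> d \<notin> M \<and> Suc (lev d) = lev c \<and> d < c}"
    using assms(2) by (auto simp: elig_def)
  also have "{d. d \<le> n \<and> d \<notin> M \<and> lev d = lev c \<and> c < d} = {d \<in> {d. (d, False) \<in> set (R0 ! k)}. d > c}"
    using k unmarked_run[of k] by auto
  also have "{d. d \<le> n \<and> d \<notin> M \<and> Suc (lev d) = lev c \<and> d < c} =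
      {d. Suc k < length R0 \<and> d \<in> {d. (d, False) \<in> set (R0 ! Suc k)} \<and> d < c}"
    using len k(1) below unmarked_run[of "Suc k"] by auto
  finally have "elig c \<inter> insert 0 {1..n} = {d \<in> {d. (d, False) \<in> set (R0 ! k)}. d > c} \<union>
      {d. Suc k < length R0 \<and> d \<in> {d. (d, False) \<in> set (R0 ! Suc k)} \<and> d < c}" .
  then show ?thesis by (rule card_eq_add[rotated]) auto
qed

text \<open>The previous run is one level higher. If \<open>k = 0\<close>, then \<open>c\<close> is
  on the highest level and both counts above it are empty.\<close>

lemma card_elig_marked:
  assumes "c \<in> {1..n}" "c \<in> M" "k = run_index R0 c"
  shows "card (elig c \<inter> insert 0 {1..n}) = card {d \<in> {d. (d, False) \<in> set (R0 ! k)}. d < c} +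
    card {d. 0 < k \<and> d \<in> {d. (d, False) \<in> set (R0 ! (k - 1))} \<and> d > c}"
proof -
  have k: "k < length R" "lev c = length R - k" using lev_pos[OF assms(1)] lev_index(3)[of c] assms by auto
  have above: "lev d = Suc (lev c) \<longleftrightarrow> 0 < k \<and> lev d = length R - (k - 1)" if "d \<le> n" for d
    using run_level_le[OF that] k by auto
  have "elig c \<inter> insert 0 {1..n} = {d. d \<le> n \<and> d \<notin> M \<and> lev d = lev c \<and> d < c} \<union>
      {d. d \<le> n \<and> d \<notin> M \<and> lev d = Suc (lev c) \<and> c < d}"
    using assms(2) by (auto simp: elig_def)
  also have "{d. d \<le> n \<and> d \<notin> M \<and> lev d = lev c \<and> d < c} = {d \<in> {d. (d, False) \<in> set (R0 ! k)}. d < c}"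
    using k unmarked_run[of k] by auto
  also have "{d. d \<le> n \<and> d \<notin> M \<and> lev d = Suc (lev c) \<and> c < d} =
      {d. 0 < k \<and> d \<in> {d. (d, False) \<in> set (R0 ! (k - 1))} \<and> d > c}"
    using k above unmarked_run[of "k - 1"] by auto
  finally have "elig c \<inter> insert 0 {1..n} = {d \<in> {d. (d, False) \<in> set (R0 ! k)}. d < c} \<union>
      {d. 0 < k \<and> d \<in> {d. (d, False) \<in> set (R0 ! (k - 1))} \<and> d > c}" .
  then show ?thesis by (rule card_eq_add[rotated]) auto
qed

lemma schedule_number_eq:
  assumes "tau_star Bs = ts" "c \<in> {1..n}"
  shows "schedule_number Bs c = card (elig c \<inter> insert 0 {1..n})"
proof -
  define k where "k = run_index R0 c"
  have k: "k \<le> length R" "lev c = length R - k" using lev_index[of c] assms(2) by (auto simp: k_def)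
  have "c \<in> {d. (d, False) \<in> set (R0 ! k)} \<longleftrightarrow> c \<notin> M"
    using unmarked_run[OF k(1)] k(2) assms(2) by auto
  then show ?thesis
    using card_elig_unmarked[OF assms(2) _ k_def] card_elig_marked[OF assms(2) _ k_def]
    unfolding schedule_number_def assms(1) Let_def run_index_def[symmetric] k_def[symmetric] by auto
qed

lemma sum_lev: "(\<Sum>c\<in>{1..n}. lev c) = maj (map fst ts) + n"
proof -
  have "maj (map fst (ts @ [(0, False)])) = (\<Sum>c\<in>fst ` set (ts @ [(0, False)]). lev c)"
    by (rule maj_eq_sum_run_level[OF dist0])
  moreover have "fst ` set (ts @ [(0, False)]) = insert 0 {1..n}" using letters by auto
  moreover have "length ts = n" using distinct_card[OF dist] letters by simp
  moreover have "0 \<notin> set (map fst ts)" using letters by simp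
  ultimately show ?thesis using maj_snoc_0[of "map fst ts"] lev_zero by simp
qed

text \<open>The cars of level \<open>d + 1\<close> form one run, which is already sorted, so listing
  the diagonals from the top reproduces the runs in their order.\<close>

lemma mpf_type_eq:
  assumes v: "valid_rows n (mpf_cols P) (mpf_cars P) M" and mc: "marked_cars P = M"
    and lev: "\<And>j. j < n \<Longrightarrow> lev (mpf_cars P ! j) = Suc (j - mpf_cols P ! j)"
  shows "mpf_type n P = ts"
proof -
  let ?L = "length R"
  define blk where "blk d = map (\<lambda>c. (c, c \<in> M)) (sorted_list_of_set (diagonal_cars P d))" for d
  have cs: "length (mpf_cars P) = n" "set (mpf_cars P) = {1..n}" using v by (auto simp: valid_rows_def)
  have D: "diagonal_cars P d = {c \<in> {1..n}. lev c = Suc d}" for d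
    unfolding diagonal_cars_eq[OF v] cs(2)[symmetric] using lev cs(1) by (force simp: in_set_conv_nth)
  have Ln: "?L \<le> n"
    using length_le_length_concat[OF Nil_notin_increasing_runs[of ts]] distinct_card[OF dist] letters by simp
  \<comment> \<open>The type ranges over \<open>n\<close> diagonals, but only the lowest
    \<open>?L\<close> of them can hold cars.\<close>
  have empty: "blk d = []" if "?L \<le> d" for d
  proof -
    have "diagonal_cars P d = {}" unfolding D using run_level_le that by fastforce
    then show ?thesis by (simp add: blk_def)
  qed
  have run: "blk (?L - 1 - k) = R ! k" if k: "k < ?L" for k
  proof -
    have R0k: "R0 ! k = R ! k" "R ! k \<in> set R" using k by (simp_all add: R0_eq nth_append)
    have "diagonal_cars P (?L - 1 - k) = fst ` set (R ! k)"
    proof (intro equalityI subsetI)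
      fix c assume "c \<in> diagonal_cars P (?L - 1 - k)"
      then have c: "c \<in> {1..n}" "lev c = Suc (?L - 1 - k)" unfolding D by auto
      then have "run_index R0 c = k" using lev_index(1,3)[of c] k by auto
      then show "c \<in> fst ` set (R ! k)" using lev_index(2)[of c] c(1) R0k by auto
    next
      fix c assume c: "c \<in> fst ` set (R ! k)"
      then have "c \<in> fst ` set (concat R)" unfolding set_concat using R0k(2) by blast
      then have "c \<in> {1..n}" using letters by simp
      then show "c \<in> diagonal_cars P (?L - 1 - k)" unfolding D using lev_eq[of k c] c k R0k(1) by auto
    qed
    moreover have "sorted_list_of_set (fst ` set (R ! k)) = map fst (R ! k)"
      using sorted_list_of_set.idem_if_sorted_distinct[of "map fst (R ! k)"]
        sorted_increasing_runs[OF R0k(2)] strict_sorted_iff by auto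
    moreover have "map (\<lambda>c. (c, c \<in> M)) (map fst (R ! k)) = R ! k"
    proof -
      have "(fst x, fst x \<in> M) = x" if "x \<in> set (R ! k)" for x
      proof -
        have "x \<in> set (concat R)" unfolding set_concat using that R0k(2) by blast
        then show ?thesis using mark_iff[of "fst x" "snd x"] by (simp add: prod_eq_iff)
      qed
      then show ?thesis by (simp add: map_idI)
    qed
    ultimately show ?thesis by (simp add: blk_def)
  qed
  have "mpf_type n P = concat (map blk (rev [0..<n]))" by (simp add: mpf_type_def mc blk_def[abs_def])
  also have "[0..<n] = [0..<?L] @ [?L..<n]" using Ln upt_add_eq_append[of 0 ?L "n - ?L"] by simp
  also have "concat (map blk (rev ([0..<?L] @ [?L..<n]))) = concat (map blk (rev [0..<?L]))"
    using empty by simp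
  also have "map blk (rev [0..<?L]) = R" by (rule nth_equalityI) (use run in \<open>simp_all add: rev_nth\<close>)
  finally show ?thesis by simp
qed

text \<open>Listed increasingly, the diagonals are the runs of the type, because some car of each
  higher nonempty diagonal exceeds a car of the diagonal below. Hence the run of a car tells its
  diagonal.\<close>

lemma levels_of_type:
  assumes P: "marked_parking_function n P" "mpf_type n P = ts"
  shows "marked_cars P = M" "\<And>j. j < n \<Longrightarrow> lev (mpf_cars P ! j) = Suc (j - mpf_cols P ! j)"
proof -
  let ?cs = "mpf_cars P" and ?a = "mpf_cols P" and ?mc = "marked_cars P"
  define dg where "dg j = j - ?a ! j" for j
  define blk where "blk d = map (\<lambda>c. (c, c \<in> ?mc)) (sorted_list_of_set (diagonal_cars P d))" for d
  have v: "valid_rows n ?a ?cs ?mc" by (rule valid_rows_of_mpf(1)[OF P(1)])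
  have cs: "length ?cs = n" "set ?cs = {1..n}" and a: "length ?a = n" "sorted ?a" "\<And>j. j < n \<Longrightarrow> ?a ! j \<le> j"
    and mc: "?mc \<subseteq> {1..n}" and col: "\<And>j. Suc j < n \<Longrightarrow> ?a ! j = ?a ! Suc j \<Longrightarrow> ?cs ! j < ?cs ! Suc j"
    using v by (auto simp: valid_rows_def)
  have D: "diagonal_cars P d = {?cs ! j | j. j < n \<and> dg j = d}" for d
    unfolding diagonal_cars_eq[OF v] dg_def ..
  have finD: "finite (diagonal_cars P d)" for d unfolding D by simp
  have set_blk: "set (blk d) = (\<lambda>c. (c, c \<in> ?mc)) ` diagonal_cars P d" for d
    using finD by (simp add: blk_def)
  have ts: "ts = concat (map blk (rev [0..<n]))" using P(2) by (simp add: mpf_type_def blk_def[abs_def])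
  have set_ts: "set ts = (\<Union>d<n. set (blk d))" by (subst ts) auto
  have dgn: "dg j < n" if "j < n" for j using that by (simp add: dg_def)
  show mcM: "?mc = M"
  proof (intro equalityI subsetI)
    fix c assume c: "c \<in> ?mc"
    then obtain j where j: "j < n" "c = ?cs ! j" using mc cs by (metis in_set_conv_nth subsetD)
    then have "(c, True) \<in> set (blk (dg j))" using c by (auto simp: set_blk D)
    then show "c \<in> M" using dgn[OF j(1)] by (auto simp: M_def set_ts)
  qed (auto simp: M_def set_ts set_blk)
  \<comment> \<open>The nonempty diagonals will turn out to be exactly those below
    \<open>m\<close>.\<close>
  define m where "m = (LEAST m. \<forall>j<n. dg j < m)"
  have m: "\<forall>j<n. dg j < m" unfolding m_def by (rule LeastI[of _ n]) (use dgn in auto)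
  have mn: "m \<le> n" unfolding m_def by (rule Least_le) (use dgn in auto)
  have reach: "\<exists>j<n. d \<le> dg j" if "d < m" for d
    using not_less_Least[of d "\<lambda>m. \<forall>j<n. dg j < m"] that by (auto simp: m_def not_less)
  have rise: "\<exists>j. Suc j < n \<and> dg j = d \<and> dg (Suc j) = Suc d \<and> ?cs ! j < ?cs ! Suc j" if d: "Suc d < m" for d
  proof -
    \<comment> \<open>Take the lowest row on diagonal \<open>Suc d\<close> or above. The row before
      it is on diagonal \<open>d\<close> or below, and diagonals grow by at most one per row; so
      both rows share a column and their cars increase.\<close>
    define j where "j = (LEAST j. j < n \<and> Suc d \<le> dg j)"
    have j: "j < n" "Suc d \<le> dg j"
      using LeastI_ex[of "\<lambda>j. j < n \<and> Suc d \<le> dg j"] reach[OF d] by (auto simp: j_def)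
    then obtain i where i: "j = Suc i" by (cases j) (auto simp: dg_def)
    have "dg i \<le> d" using not_less_Least[of i "\<lambda>j. j < n \<and> Suc d \<le> dg j"] i j(1) by (auto simp: j_def)
    moreover have "?a ! i \<le> ?a ! Suc i" using sorted_nth_mono[OF a(2), of i "Suc i"] a(1) j(1) i by simp
    ultimately have "dg i = d" "dg (Suc i) = Suc d" "?a ! i = ?a ! Suc i"
      using j i a(3)[of i] a(3)[of "Suc i"] by (auto simp: dg_def)
    then show ?thesis using col[of i] j(1) i by auto
  qed
  have ne: "diagonal_cars P d \<noteq> {}" if "d < m" for d
  proof (cases d)
    case 0
    then have "0 < n" using reach[OF that] by auto
    then show ?thesis using 0 by (auto simp: D dg_def intro!: exI[of _ 0])
  next
    case (Suc d')
    then show ?thesis using rise[of d'] that by (auto simp: D)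
  qed
  have fst_blk: "map fst (blk d) = sorted_list_of_set (diagonal_cars P d)" for d
    by (simp add: blk_def comp_def)
  have blk_ne: "blk d \<noteq> []" if "d < m" for d using ne[OF that] finD by (simp add: blk_def)
  \<comment> \<open>The pair from \<open>rise\<close> puts the smallest car of diagonal
    \<open>d\<close> below the largest car of diagonal \<open>Suc d\<close>.\<close>
  have desc: "\<not> fst (last (blk (Suc d))) < fst (hd (blk d))" if d: "Suc d < m" for d
  proof -
    obtain j where j: "Suc j < n" "dg j = d" "dg (Suc j) = Suc d" "?cs ! j < ?cs ! Suc j" using rise[OF d] by blast
    then have "?cs ! j \<in> diagonal_cars P d" "?cs ! Suc j \<in> diagonal_cars P (Suc d)" unfolding D by auto
    then have "hd (map fst (blk d)) \<le> ?cs ! j" "?cs ! Suc j \<le> last (map fst (blk (Suc d)))"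
      unfolding fst_blk using finD[of d] finD[of "Suc d"]
        sorted_hd_last[of "sorted_list_of_set (diagonal_cars P d)" "?cs ! j"]
        sorted_hd_last[of "sorted_list_of_set (diagonal_cars P (Suc d))" "?cs ! Suc j"] by simp_all
    then show ?thesis using blk_ne[of d] blk_ne[of "Suc d"] d j(4) by (simp add: hd_map last_map)
  qed
  define bs where "bs = map blk (rev [0..<m]) @ [[(0, False)]]"
  have nth_bs: "bs ! k = blk (m - 1 - k)" if "k < m" for k using that by (simp add: bs_def nth_append rev_nth)
  have "[0..<n] = [0..<m] @ [m..<n]" using mn upt_add_eq_append[of 0 m "n - m"] by simp
  moreover have "blk d = []" if "m \<le> d" for d
    using m that by (auto simp: blk_def D)
  ultimately have "ts = concat (map blk (rev [0..<m]))" unfolding ts by simp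
  then have "ts @ [(0, False)] = concat bs" by (simp add: bs_def)
  moreover have "increasing_runs (concat bs) = bs"
  proof (rule increasing_runs_concat)
    show "b \<noteq> [] \<and> sorted_wrt (<) (map fst b)" if "b \<in> set bs" for b
      using that blk_ne fst_blk by (auto simp: bs_def)
    have "\<not> fst (last (bs ! k)) < fst (hd (bs ! Suc k))" if "Suc k < length bs" for k
    proof (cases "Suc k < m")
      case True
      then have "Suc (m - 1 - Suc k) = m - 1 - k" by simp
      then show ?thesis using desc[of "m - 1 - Suc k"] nth_bs[of k] nth_bs[of "Suc k"] True by simp
    next
      case False
      \<comment> \<open>At the last joint nothing is smaller than \<open>0\<close>, so the appended
        letter starts a new run.\<close>
      then have "bs ! Suc k = [(0, False)]" using that by (simp add: bs_def nth_append)
      then show ?thesis by simp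
    qed
    then show "successively (\<lambda>b b'. \<not> fst (last b) < fst (hd b')) bs" by (simp add: successively_conv_nth)
  qed
  ultimately have R0: "R0 = bs" by simp
  then have lenR: "length R = m" using arg_cong[OF R0_eq, of length] by (simp add: bs_def)
  show "lev (?cs ! j) = Suc (j - ?a ! j)" if j: "j < n" for j
  proof -
    have dm: "dg j < m" using m j by blast
    have "R0 ! (m - 1 - dg j) = blk (dg j)" unfolding R0 using nth_bs[of "m - 1 - dg j"] dm by simp
    moreover have "?cs ! j \<in> fst ` set (blk (dg j))" unfolding set_blk D using j by force
    ultimately have "lev (?cs ! j) = m - (m - 1 - dg j)" using lev_eq[of "m - 1 - dg j"] lenR by simp
    then show ?thesis using dm by (simp add: dg_def)
  qed
qed

text \<open>Reading off the cars is a bijection from the parking functions of type \<open>ts\<close>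
  onto \<open>words {1..n}\<close>: the type fixes levels and marks, and the levels fix the columns.
  The area is the same for all of them.\<close>

lemma sum_mpf:
  fixes q t :: "'a::field"
  shows "(\<Sum>P | marked_parking_function n P \<and> mpf_type n P = ts. t ^ mpf_area P * q powi mpf_dinv P) =
    t ^ maj (map fst ts) * (\<Prod>c=1..n. q_number q (card (elig c \<inter> insert 0 {1..n})))"
proof -
  let ?a = "\<lambda>cs. map (\<lambda>j. Suc j - lev (cs ! j)) [0..<n]"
  let ?T = "{P. marked_parking_function n P \<and> mpf_type n P = ts}"
  have "(\<Sum>P\<in>?T. t ^ mpf_area P * q powi mpf_dinv P) =
      (\<Sum>cs\<in>words {1..n}. t ^ maj (map fst ts) * q ^ word_dinv cs)"
  proof (rule sum.reindex_bij_witness[where i = "\<lambda>cs. mpf_of n (?a cs) cs M" and j = mpf_cars])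
    fix P assume "P \<in> ?T"
    then have P: "marked_parking_function n P" "mpf_type n P = ts" by auto
    note lv = levels_of_type[OF P]
    have v: "valid_rows n (mpf_cols P) (mpf_cars P) M" using valid_rows_of_mpf(1)[OF P(1)] lv(1) by simp
    have a: "length (mpf_cols P) = n" "\<And>j. j < n \<Longrightarrow> mpf_cols P ! j \<le> j"
      and cs: "length (mpf_cars P) = n" "distinct (mpf_cars P)" "set (mpf_cars P) = {1..n}"
      using v by (auto simp: valid_rows_def)
    have "?a (mpf_cars P) = mpf_cols P"
      using a lv(2) by (intro nth_equalityI) auto
    then show "mpf_of n (?a (mpf_cars P)) (mpf_cars P) M = P"
      using valid_rows_of_mpf(2)[OF P(1)] lv(1) by simp
    show "mpf_cars P \<in> words {1..n}" using words_of_valid_rows[OF v lv(2)] .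
    have "(\<Sum>j<n. lev (mpf_cars P ! j)) = (\<Sum>c\<in>{1..n}. lev c)"
      unfolding cs(3)[symmetric] using sum_list_distinct_conv_sum_set[OF cs(2), of lev] cs(1)
      by (simp add: sum_list_sum_nth lessThan_atLeast0)
    \<comment> \<open>Each level is one more than the diagonal; the resulting \<open>n\<close>
      cancels against the one in \<open>sum_lev\<close>.\<close>
    moreover have "(\<Sum>j<n. lev (mpf_cars P ! j)) = mpf_area P + n"
      unfolding mpf_area_eq[OF v] by (simp add: lv(2) sum_Suc)
    ultimately have "mpf_area P = maj (map fst ts)" using sum_lev by simp
    moreover have "mpf_dinv P = int (word_dinv (mpf_cars P))" using mpf_dinv_eq[OF P(1) lv] .
    ultimately show "t ^ maj (map fst ts) * q ^ word_dinv (mpf_cars P) = t ^ mpf_area P * q powi mpf_dinv P"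
      by simp
  next
    fix cs assume cs: "cs \<in> words {1..n}"
    note vr = valid_rows_of_words[OF cs lev_pos(1) M_subset]
    note mp = mpf_of_valid_rows[OF vr(1)]
    show "mpf_cars (mpf_of n (?a cs) cs M) = cs" by (rule mp(3))
    have "mpf_type n (mpf_of n (?a cs) cs M) = ts"
      using vr mp by (intro mpf_type_eq) simp_all
    then show "mpf_of n (?a cs) cs M \<in> ?T" using mp(1) by simp
  qed
  also have "\<dots> = t ^ maj (map fst ts) * (\<Sum>cs\<in>words {1..n}. q ^ word_dinv cs)"
    by (simp add: sum_distrib_left)
  also have "(\<Sum>cs\<in>words {1..n}. q ^ word_dinv cs) = (\<Prod>c=1..n. q_number q (card (elig c \<inter> insert 0 {1..n})))"
    using lev_pos(1) by (intro sum_words) auto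
  finally show ?thesis .
qed

end

theorem theorem3p13:
  fixes q t :: "'a::field" and n :: nat and Bs :: "nat set list"
  assumes "n \<ge> 1" and "ordered_set_partition {1..n} Bs"
  shows "(\<Sum>P\<in>MPF n Bs. t ^ mpf_area P * q powi mpf_dinv P) =
           t ^ maj (tau Bs) * (\<Prod>c=1..n. q_number q (schedule_number Bs c))"
proof -
  have tau: "set (tau Bs) = {1..n}" "distinct (tau Bs)" "map fst (tau_star Bs) = tau Bs"
    using tau_props[OF _ assms(2)] by auto
  interpret type_word n "tau_star Bs"
    using tau by unfold_locales (auto simp flip: set_map)
  show ?thesis
    using sum_mpf[of t q] schedule_number_eq[OF refl] by (simp add: MPF_def tau(3))
qed

end
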